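(* Let $\mathcal{U}$ be a universe and assume $\Omega$-resizing for $\mathcal{U}$. Then all inhabited types in $\mathcal{U}$ are $\mathcal{U},\mathcal{U}$-injective if and only if excluded middle holds in $\mathcal{U}$.
   Context: Foundation: intensional Martin-Löf type theory with $\mathbb{0},\mathbb{1},\mathbb{N},+,\Pi,\Sigma,\mathrm{Id}$ and universes $\mathcal{U},\mathcal{V},\mathcal{W},\mathcal{T}$ (not assumed cumulative), with successor $\mathcal{U}^+$ and least upper bound $\mathcal{U}\sqcup\mathcal{V}$. Univalence (hence function and propositional extensionality) and existence of propositional truncations ($\|X\|:\mathcal{U}$ for $X:\mathcal{U}$, eliminating into propositions of any universe) are assumed. A subsingleton (proposition) is a type any two of whose elements are equal. A type $X$ is inhabited if $\|X\|$ has an element. A map $j:X\to Y$ is an embedding if each fiber $j^{-1}(y):=\Sigma(x:X),\,j\,x=y$ is a subsingleton; $X\hookrightarrow Y$ is the type of embeddings. $f\sim g$ means pointwise equality. $\exists$ is the propositional truncation of $\Sigma$. A type $D$ (in any universe) is $\mathcal{U},\mathcal{V}$-injective if $$\Pi(X:\mathcal{U})\,\Pi(Y:\mathcal{V})\,\Pi(j:X\hookrightarrow Y)\,\Pi(f:X\to D),\ \exists(g:Y\to D),\ g\circ j\sim f.$$ Excluded middle in $\mathcal{U}$: $\mathrm{EM}_{\mathcal{U}}:=\Pi(P:\mathcal{U}),\ P\text{ is a subsingleton}\to P+(P\to\mathbb{0})$. $\Omega_{\mathcal{U}}:\mathcal{U}^+$ is the type of propositions in $\mathcal{U}$. $\Omega$-resizing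 for $\mathcal{U}$ says that there is $\Omega':\mathcal{U}$ with an equivalence $\Omega'\simeq\Omega_{\mathcal{U}}$. *)

theory Defs
  imports Main
begin

text \<open>
  A deep embedding of intensional Martin-Loef type theory with a hierarchy of non-cumulative
  universes, propositional truncations and univalence. Types are the terms of type some
  universe (universes are Russell-style). The universes are indexed by the natural numbers, so
  that the successor of the universe \<open>Univ i\<close> is \<open>Univ (Suc i)\<close>, the least upper bound of
  \<open>Univ i\<close> and \<open>Univ j\<close> is \<open>Univ (max i j)\<close>, and a statement about an arbitrary universe
  is a statement about \<open>Univ u\<close> for an arbitrary \<open>u\<close>. A theorem of the type theory is a type
  that has a term in the empty context.
\<close>

section \<open>Raw terms\<close>

text \<open>
  Variables are de Bruijn indices. The first argument of an eliminator is its motive. The numbers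
  of variables bound in the arguments can be read off from \<open>ren\<close> below; the most recently
  bound variable is \<open>Var 0\<close>. The last five constructors are the truncation of a type, the
  constants witnessing its defining properties, and the univalence axiom for \<open>Univ i\<close>.
\<close>

datatype tm =
    Var nat
  | Univ nat
  | Empty nat | EmptyE tm tm
  | Unit nat | Star nat | UnitE tm tm tm
  | Nat nat | Zero nat | Succ tm | NatE tm tm tm tm
  | Plus tm tm | InL tm | InR tm | PlusE tm tm tm tm
  | Pi tm tm | Lam tm tm | App tm tm
  | Sig tm tm | Pr tm tm | SigE tm tm tm
  | Idn tm tm tm | Refl tm | IdE tm tm tm tm tm
  | Trunc tm | TrIn tm | TrProp tm | TrRec tm tm
  | UA nat

abbreviation up_ren :: "(nat \<Rightarrow> nat) \<Rightarrow> nat \<Rightarrow> nat" where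
  "up_ren \<xi> \<equiv> case_nat 0 (\<lambda>n. Suc (\<xi> n))"

primrec ren :: "(nat \<Rightarrow> nat) \<Rightarrow> tm \<Rightarrow> tm" where
  "ren \<xi> (Var n) = Var (\<xi> n)"
| "ren \<xi> (Univ i) = Univ i"
| "ren \<xi> (Empty i) = Empty i"
| "ren \<xi> (EmptyE C e) = EmptyE (ren (up_ren \<xi>) C) (ren \<xi> e)"
| "ren \<xi> (Unit i) = Unit i"
| "ren \<xi> (Star i) = Star i"
| "ren \<xi> (UnitE C c e) = UnitE (ren (up_ren \<xi>) C) (ren \<xi> c) (ren \<xi> e)"
| "ren \<xi> (Nat i) = Nat i"
| "ren \<xi> (Zero i) = Zero i"
| "ren \<xi> (Succ n) = Succ (ren \<xi> n)"
| "ren \<xi> (NatE C z s n) =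
     NatE (ren (up_ren \<xi>) C) (ren \<xi> z) (ren (up_ren (up_ren \<xi>)) s) (ren \<xi> n)"
| "ren \<xi> (Plus A B) = Plus (ren \<xi> A) (ren \<xi> B)"
| "ren \<xi> (InL a) = InL (ren \<xi> a)"
| "ren \<xi> (InR b) = InR (ren \<xi> b)"
| "ren \<xi> (PlusE C l r e) =
     PlusE (ren (up_ren \<xi>) C) (ren (up_ren \<xi>) l) (ren (up_ren \<xi>) r) (ren \<xi> e)"
| "ren \<xi> (Pi A B) = Pi (ren \<xi> A) (ren (up_ren \<xi>) B)"
| "ren \<xi> (Lam A b) = Lam (ren \<xi> A) (ren (up_ren \<xi>) b)"
| "ren \<xi> (App f a) = App (ren \<xi> f) (ren \<xi> a)"
| "ren \<xi> (Sig A B) = Sig (ren \<xi> A) (ren (up_ren \<xi>) B)"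
| "ren \<xi> (Pr a b) = Pr (ren \<xi> a) (ren \<xi> b)"
| "ren \<xi> (SigE C d p) = SigE (ren (up_ren \<xi>) C) (ren (up_ren (up_ren \<xi>)) d) (ren \<xi> p)"
| "ren \<xi> (Idn A a b) = Idn (ren \<xi> A) (ren \<xi> a) (ren \<xi> b)"
| "ren \<xi> (Refl a) = Refl (ren \<xi> a)"
| "ren \<xi> (IdE C d a b p) =
     IdE (ren (up_ren (up_ren (up_ren \<xi>))) C) (ren (up_ren \<xi>) d) (ren \<xi> a) (ren \<xi> b) (ren \<xi> p)"
| "ren \<xi> (Trunc A) = Trunc (ren \<xi> A)"
| "ren \<xi> (TrIn A) = TrIn (ren \<xi> A)"
| "ren \<xi> (TrProp A) = TrProp (ren \<xi> A)"
| "ren \<xi> (TrRec A B) = TrRec (ren \<xi> A) (ren \<xi> B)"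
| "ren \<xi> (UA i) = UA i"

abbreviation wk :: "tm \<Rightarrow> tm" where
  "wk \<equiv> ren Suc"

abbreviation scons :: "tm \<Rightarrow> (nat \<Rightarrow> tm) \<Rightarrow> nat \<Rightarrow> tm"  (infixr "\<bullet>" 65) where
  "a \<bullet> \<sigma> \<equiv> case_nat a \<sigma>"

abbreviation up :: "(nat \<Rightarrow> tm) \<Rightarrow> nat \<Rightarrow> tm" where
  "up \<sigma> \<equiv> Var 0 \<bullet> (\<lambda>n. wk (\<sigma> n))"

primrec sub :: "(nat \<Rightarrow> tm) \<Rightarrow> tm \<Rightarrow> tm" where
  "sub \<sigma> (Var n) = \<sigma> n"
| "sub \<sigma> (Univ i) = Univ i"
| "sub \<sigma> (Empty i) = Empty i"
| "sub \<sigma> (EmptyE C e) = EmptyE (sub (up \<sigma>) C) (sub \<sigma> e)"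
| "sub \<sigma> (Unit i) = Unit i"
| "sub \<sigma> (Star i) = Star i"
| "sub \<sigma> (UnitE C c e) = UnitE (sub (up \<sigma>) C) (sub \<sigma> c) (sub \<sigma> e)"
| "sub \<sigma> (Nat i) = Nat i"
| "sub \<sigma> (Zero i) = Zero i"
| "sub \<sigma> (Succ n) = Succ (sub \<sigma> n)"
| "sub \<sigma> (NatE C z s n) =
     NatE (sub (up \<sigma>) C) (sub \<sigma> z) (sub (up (up \<sigma>)) s) (sub \<sigma> n)"
| "sub \<sigma> (Plus A B) = Plus (sub \<sigma> A) (sub \<sigma> B)"
| "sub \<sigma> (InL a) = InL (sub \<sigma> a)"
| "sub \<sigma> (InR b) = InR (sub \<sigma> b)"
| "sub \<sigma> (PlusE C l r e) =
     PlusE (sub (up \<sigma>) C) (sub (up \<sigma>) l) (sub (up \<sigma>) r) (sub \<sigma> e)"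
| "sub \<sigma> (Pi A B) = Pi (sub \<sigma> A) (sub (up \<sigma>) B)"
| "sub \<sigma> (Lam A b) = Lam (sub \<sigma> A) (sub (up \<sigma>) b)"
| "sub \<sigma> (App f a) = App (sub \<sigma> f) (sub \<sigma> a)"
| "sub \<sigma> (Sig A B) = Sig (sub \<sigma> A) (sub (up \<sigma>) B)"
| "sub \<sigma> (Pr a b) = Pr (sub \<sigma> a) (sub \<sigma> b)"
| "sub \<sigma> (SigE C d p) = SigE (sub (up \<sigma>) C) (sub (up (up \<sigma>)) d) (sub \<sigma> p)"
| "sub \<sigma> (Idn A a b) = Idn (sub \<sigma> A) (sub \<sigma> a) (sub \<sigma> b)"
| "sub \<sigma> (Refl a) = Refl (sub \<sigma> a)"
| "sub \<sigma> (IdE C d a b p) =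
     IdE (sub (up (up (up \<sigma>))) C) (sub (up \<sigma>) d) (sub \<sigma> a) (sub \<sigma> b) (sub \<sigma> p)"
| "sub \<sigma> (Trunc A) = Trunc (sub \<sigma> A)"
| "sub \<sigma> (TrIn A) = TrIn (sub \<sigma> A)"
| "sub \<sigma> (TrProp A) = TrProp (sub \<sigma> A)"
| "sub \<sigma> (TrRec A B) = TrRec (sub \<sigma> A) (sub \<sigma> B)"
| "sub \<sigma> (UA i) = UA i"

abbreviation inst :: "tm \<Rightarrow> tm \<Rightarrow> tm" where
  "inst B a \<equiv> sub (a \<bullet> Var) B"


section \<open>Types that occur in the rules\<close>

definition arrow :: "tm \<Rightarrow> tm \<Rightarrow> tm" where
  "arrow A B = Pi A (wk B)"

definition times :: "tm \<Rightarrow> tm \<Rightarrow> tm" where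
  "times A B = Sig A (wk B)"

text \<open>First projection out of a \<open>\<Sigma>\<close>-type whose index type is \<open>A\<close>.\<close>

definition pr1 :: "tm \<Rightarrow> tm \<Rightarrow> tm" where
  "pr1 A p = SigE (wk A) (Var 1) p"

definition is_prop :: "tm \<Rightarrow> tm" where
  "is_prop A = Pi A (Pi (wk A) (Idn (wk (wk A)) (Var 1) (Var 0)))"

definition idfun :: "tm \<Rightarrow> tm" where
  "idfun A = Lam A (Var 0)"

text \<open>\<open>g \<circ> f\<close>, where \<open>A\<close> is the domain of \<open>f\<close>.\<close>

definition comp :: "tm \<Rightarrow> tm \<Rightarrow> tm \<Rightarrow> tm" where
  "comp A g f = Lam A (App (wk g) (App (wk f) (Var 0)))"

text \<open>Pointwise equality of the maps \<open>f\<close> and \<open>g\<close> from \<open>A\<close> to \<open>B\<close>.\<close>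

definition homotopy :: "tm \<Rightarrow> tm \<Rightarrow> tm \<Rightarrow> tm \<Rightarrow> tm" where
  "homotopy A B f g = Pi A (Idn (wk B) (App (wk f) (Var 0)) (App (wk g) (Var 0)))"

text \<open>Equivalences are the maps with a right inverse and a left inverse.\<close>

definition is_equiv :: "tm \<Rightarrow> tm \<Rightarrow> tm \<Rightarrow> tm" where
  "is_equiv A B f =
     times
       (Sig (arrow B A) (homotopy (wk B) (wk B) (comp (wk B) (wk f) (Var 0)) (idfun (wk B))))
       (Sig (arrow B A) (homotopy (wk A) (wk A) (comp (wk A) (Var 0) (wk f)) (idfun (wk A))))"

definition equiv :: "tm \<Rightarrow> tm \<Rightarrow> tm" where
  "equiv A B = Sig (arrow A B) (is_equiv (wk A) (wk B) (Var 0))"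

definition id_equiv :: "tm \<Rightarrow> tm" where
  "id_equiv A =
     Pr (idfun A)
       (Pr (Pr (idfun A) (Lam A (Refl (Var 0)))) (Pr (idfun A) (Lam A (Refl (Var 0)))))"

text \<open>The canonical map from \<open>A = B\<close> to \<open>A \<simeq> B\<close>, for \<open>A\<close> and \<open>B\<close> in \<open>Univ i\<close>.\<close>

definition id_to_equiv :: "nat \<Rightarrow> tm \<Rightarrow> tm \<Rightarrow> tm" where
  "id_to_equiv i A B =
     Lam (Idn (Univ i) A B)
       (IdE (equiv (Var 2) (Var 1)) (id_equiv (Var 0)) (wk A) (wk B) (Var 0))"

definition univalence :: "nat \<Rightarrow> tm" where
  "univalence i =
     Pi (Univ i) (Pi (Univ i)
       (is_equiv (Idn (Univ i) (Var 1) (Var 0)) (equiv (Var 1) (Var 0))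
          (id_to_equiv i (Var 1) (Var 0))))"


section \<open>Contexts, typing and judgemental equality\<close>

text \<open>
  Contexts are lists whose head is the type of \<open>Var 0\<close>. There is no rule for the
  inclusion of a universe in another one, and no eta rule except for \<open>\<Pi>\<close>-types.
\<close>

inductive ctx :: "tm list \<Rightarrow> bool"
  and typing :: "tm list \<Rightarrow> tm \<Rightarrow> tm \<Rightarrow> bool"
    ("_ \<turnstile> _ \<Colon> _" [51, 51, 51] 50)
  and eqtm :: "tm list \<Rightarrow> tm \<Rightarrow> tm \<Rightarrow> tm \<Rightarrow> bool"
    ("_ \<turnstile> _ \<doteq> _ \<Colon> _" [51, 51, 51, 51] 50)
where
  ctx_Nil: "ctx []"
| ctx_Cons: "ctx \<Gamma> \<Longrightarrow> \<Gamma> \<turnstile> A \<Colon> Univ i \<Longrightarrow> ctx (A # \<Gamma>)"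

| ty_Var: "ctx \<Gamma> \<Longrightarrow> n < length \<Gamma> \<Longrightarrow> \<Gamma> \<turnstile> Var n \<Colon> ren (\<lambda>k. k + Suc n) (\<Gamma> ! n)"
| ty_Univ: "ctx \<Gamma> \<Longrightarrow> \<Gamma> \<turnstile> Univ i \<Colon> Univ (Suc i)"
| ty_conv: "\<Gamma> \<turnstile> t \<Colon> A \<Longrightarrow> \<Gamma> \<turnstile> A \<doteq> B \<Colon> Univ i \<Longrightarrow> \<Gamma> \<turnstile> t \<Colon> B"

| ty_Empty: "ctx \<Gamma> \<Longrightarrow> \<Gamma> \<turnstile> Empty i \<Colon> Univ i"
| ty_EmptyE: "Empty i # \<Gamma> \<turnstile> C \<Colon> Univ k \<Longrightarrow> \<Gamma> \<turnstile> e \<Colon> Empty i \<Longrightarrow>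
    \<Gamma> \<turnstile> EmptyE C e \<Colon> inst C e"

| ty_Unit: "ctx \<Gamma> \<Longrightarrow> \<Gamma> \<turnstile> Unit i \<Colon> Univ i"
| ty_Star: "ctx \<Gamma> \<Longrightarrow> \<Gamma> \<turnstile> Star i \<Colon> Unit i"
| ty_UnitE: "Unit i # \<Gamma> \<turnstile> C \<Colon> Univ k \<Longrightarrow> \<Gamma> \<turnstile> c \<Colon> inst C (Star i) \<Longrightarrow>
    \<Gamma> \<turnstile> e \<Colon> Unit i \<Longrightarrow> \<Gamma> \<turnstile> UnitE C c e \<Colon> inst C e"

| ty_Nat: "ctx \<Gamma> \<Longrightarrow> \<Gamma> \<turnstile> Nat i \<Colon> Univ i"
| ty_Zero: "ctx \<Gamma> \<Longrightarrow> \<Gamma> \<turnstile> Zero i \<Colon> Nat i"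
| ty_Succ: "\<Gamma> \<turnstile> n \<Colon> Nat i \<Longrightarrow> \<Gamma> \<turnstile> Succ n \<Colon> Nat i"
| ty_NatE: "Nat i # \<Gamma> \<turnstile> C \<Colon> Univ k \<Longrightarrow> \<Gamma> \<turnstile> z \<Colon> inst C (Zero i) \<Longrightarrow>
    C # Nat i # \<Gamma> \<turnstile> s \<Colon> sub (Succ (Var 1) \<bullet> (\<lambda>k. Var (k + 2))) C \<Longrightarrow>
    \<Gamma> \<turnstile> n \<Colon> Nat i \<Longrightarrow> \<Gamma> \<turnstile> NatE C z s n \<Colon> inst C n"

| ty_Plus: "\<Gamma> \<turnstile> A \<Colon> Univ i \<Longrightarrow> \<Gamma> \<turnstile> B \<Colon> Univ j \<Longrightarrow> \<Gamma> \<turnstile> Plus A B \<Colon> Univ (max i j)"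
| ty_InL: "\<Gamma> \<turnstile> a \<Colon> A \<Longrightarrow> \<Gamma> \<turnstile> A \<Colon> Univ i \<Longrightarrow> \<Gamma> \<turnstile> B \<Colon> Univ j \<Longrightarrow>
    \<Gamma> \<turnstile> InL a \<Colon> Plus A B"
| ty_InR: "\<Gamma> \<turnstile> b \<Colon> B \<Longrightarrow> \<Gamma> \<turnstile> A \<Colon> Univ i \<Longrightarrow> \<Gamma> \<turnstile> B \<Colon> Univ j \<Longrightarrow>
    \<Gamma> \<turnstile> InR b \<Colon> Plus A B"
| ty_PlusE: "Plus A B # \<Gamma> \<turnstile> C \<Colon> Univ k \<Longrightarrow>
    A # \<Gamma> \<turnstile> l \<Colon> sub (InL (Var 0) \<bullet> (\<lambda>k. Var (k + 1))) C \<Longrightarrow>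
    B # \<Gamma> \<turnstile> r \<Colon> sub (InR (Var 0) \<bullet> (\<lambda>k. Var (k + 1))) C \<Longrightarrow>
    \<Gamma> \<turnstile> e \<Colon> Plus A B \<Longrightarrow> \<Gamma> \<turnstile> PlusE C l r e \<Colon> inst C e"

| ty_Pi: "\<Gamma> \<turnstile> A \<Colon> Univ i \<Longrightarrow> A # \<Gamma> \<turnstile> B \<Colon> Univ j \<Longrightarrow> \<Gamma> \<turnstile> Pi A B \<Colon> Univ (max i j)"
| ty_Lam: "\<Gamma> \<turnstile> A \<Colon> Univ i \<Longrightarrow> A # \<Gamma> \<turnstile> B \<Colon> Univ j \<Longrightarrow> A # \<Gamma> \<turnstile> b \<Colon> B \<Longrightarrow>
    \<Gamma> \<turnstile> Lam A b \<Colon> Pi A B"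
| ty_App: "\<Gamma> \<turnstile> f \<Colon> Pi A B \<Longrightarrow> \<Gamma> \<turnstile> a \<Colon> A \<Longrightarrow> \<Gamma> \<turnstile> App f a \<Colon> inst B a"

| ty_Sig: "\<Gamma> \<turnstile> A \<Colon> Univ i \<Longrightarrow> A # \<Gamma> \<turnstile> B \<Colon> Univ j \<Longrightarrow> \<Gamma> \<turnstile> Sig A B \<Colon> Univ (max i j)"
| ty_Pr: "\<Gamma> \<turnstile> A \<Colon> Univ i \<Longrightarrow> A # \<Gamma> \<turnstile> B \<Colon> Univ j \<Longrightarrow> \<Gamma> \<turnstile> a \<Colon> A \<Longrightarrow>
    \<Gamma> \<turnstile> b \<Colon> inst B a \<Longrightarrow> \<Gamma> \<turnstile> Pr a b \<Colon> Sig A B"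
| ty_SigE: "Sig A B # \<Gamma> \<turnstile> C \<Colon> Univ k \<Longrightarrow>
    B # A # \<Gamma> \<turnstile> d \<Colon> sub (Pr (Var 1) (Var 0) \<bullet> (\<lambda>k. Var (k + 2))) C \<Longrightarrow>
    \<Gamma> \<turnstile> p \<Colon> Sig A B \<Longrightarrow> \<Gamma> \<turnstile> SigE C d p \<Colon> inst C p"

| ty_Idn: "\<Gamma> \<turnstile> A \<Colon> Univ i \<Longrightarrow> \<Gamma> \<turnstile> a \<Colon> A \<Longrightarrow> \<Gamma> \<turnstile> b \<Colon> A \<Longrightarrow>
    \<Gamma> \<turnstile> Idn A a b \<Colon> Univ i"
| ty_Refl: "\<Gamma> \<turnstile> A \<Colon> Univ i \<Longrightarrow> \<Gamma> \<turnstile> a \<Colon> A \<Longrightarrow> \<Gamma> \<turnstile> Refl a \<Colon> Idn A a a"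
| ty_IdE: "Idn (wk (wk A)) (Var 1) (Var 0) # wk A # A # \<Gamma> \<turnstile> C \<Colon> Univ k \<Longrightarrow>
    A # \<Gamma> \<turnstile> d \<Colon> sub (Refl (Var 0) \<bullet> Var 0 \<bullet> Var 0 \<bullet> (\<lambda>k. Var (k + 1))) C \<Longrightarrow>
    \<Gamma> \<turnstile> a \<Colon> A \<Longrightarrow> \<Gamma> \<turnstile> b \<Colon> A \<Longrightarrow> \<Gamma> \<turnstile> p \<Colon> Idn A a b \<Longrightarrow>
    \<Gamma> \<turnstile> IdE C d a b p \<Colon> sub (p \<bullet> b \<bullet> a \<bullet> Var) C"

| ty_Trunc: "\<Gamma> \<turnstile> A \<Colon> Univ i \<Longrightarrow> \<Gamma> \<turnstile> Trunc A \<Colon> Univ i"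
| ty_TrIn: "\<Gamma> \<turnstile> A \<Colon> Univ i \<Longrightarrow> \<Gamma> \<turnstile> TrIn A \<Colon> arrow A (Trunc A)"
| ty_TrProp: "\<Gamma> \<turnstile> A \<Colon> Univ i \<Longrightarrow> \<Gamma> \<turnstile> TrProp A \<Colon> is_prop (Trunc A)"
| ty_TrRec: "\<Gamma> \<turnstile> A \<Colon> Univ i \<Longrightarrow> \<Gamma> \<turnstile> B \<Colon> Univ j \<Longrightarrow>
    \<Gamma> \<turnstile> TrRec A B \<Colon> arrow (is_prop B) (arrow (arrow A B) (arrow (Trunc A) B))"
| ty_UA: "ctx \<Gamma> \<Longrightarrow> \<Gamma> \<turnstile> UA i \<Colon> univalence i"

| eq_refl: "\<Gamma> \<turnstile> t \<Colon> A \<Longrightarrow> \<Gamma> \<turnstile> t \<doteq> t \<Colon> A"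
| eq_sym: "\<Gamma> \<turnstile> t \<doteq> u \<Colon> A \<Longrightarrow> \<Gamma> \<turnstile> u \<doteq> t \<Colon> A"
| eq_trans: "\<Gamma> \<turnstile> t \<doteq> u \<Colon> A \<Longrightarrow> \<Gamma> \<turnstile> u \<doteq> v \<Colon> A \<Longrightarrow> \<Gamma> \<turnstile> t \<doteq> v \<Colon> A"
| eq_conv: "\<Gamma> \<turnstile> t \<doteq> u \<Colon> A \<Longrightarrow> \<Gamma> \<turnstile> A \<doteq> B \<Colon> Univ i \<Longrightarrow> \<Gamma> \<turnstile> t \<doteq> u \<Colon> B"

| beta_UnitE: "Unit i # \<Gamma> \<turnstile> C \<Colon> Univ k \<Longrightarrow> \<Gamma> \<turnstile> c \<Colon> inst C (Star i) \<Longrightarrow>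
    \<Gamma> \<turnstile> UnitE C c (Star i) \<doteq> c \<Colon> inst C (Star i)"
| beta_Zero: "Nat i # \<Gamma> \<turnstile> C \<Colon> Univ k \<Longrightarrow> \<Gamma> \<turnstile> z \<Colon> inst C (Zero i) \<Longrightarrow>
    C # Nat i # \<Gamma> \<turnstile> s \<Colon> sub (Succ (Var 1) \<bullet> (\<lambda>k. Var (k + 2))) C \<Longrightarrow>
    \<Gamma> \<turnstile> NatE C z s (Zero i) \<doteq> z \<Colon> inst C (Zero i)"
| beta_Succ: "Nat i # \<Gamma> \<turnstile> C \<Colon> Univ k \<Longrightarrow> \<Gamma> \<turnstile> z \<Colon> inst C (Zero i) \<Longrightarrow>
    C # Nat i # \<Gamma> \<turnstile> s \<Colon> sub (Succ (Var 1) \<bullet> (\<lambda>k. Var (k + 2))) C \<Longrightarrow>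
    \<Gamma> \<turnstile> n \<Colon> Nat i \<Longrightarrow>
    \<Gamma> \<turnstile> NatE C z s (Succ n) \<doteq> sub (NatE C z s n \<bullet> n \<bullet> Var) s \<Colon> inst C (Succ n)"
| beta_InL: "Plus A B # \<Gamma> \<turnstile> C \<Colon> Univ k \<Longrightarrow>
    A # \<Gamma> \<turnstile> l \<Colon> sub (InL (Var 0) \<bullet> (\<lambda>k. Var (k + 1))) C \<Longrightarrow>
    B # \<Gamma> \<turnstile> r \<Colon> sub (InR (Var 0) \<bullet> (\<lambda>k. Var (k + 1))) C \<Longrightarrow>
    \<Gamma> \<turnstile> a \<Colon> A \<Longrightarrow> \<Gamma> \<turnstile> PlusE C l r (InL a) \<doteq> inst l a \<Colon> inst C (InL a)"
| beta_InR: "Plus A B # \<Gamma> \<turnstile> C \<Colon> Univ k \<Longrightarrow>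
    A # \<Gamma> \<turnstile> l \<Colon> sub (InL (Var 0) \<bullet> (\<lambda>k. Var (k + 1))) C \<Longrightarrow>
    B # \<Gamma> \<turnstile> r \<Colon> sub (InR (Var 0) \<bullet> (\<lambda>k. Var (k + 1))) C \<Longrightarrow>
    \<Gamma> \<turnstile> b \<Colon> B \<Longrightarrow> \<Gamma> \<turnstile> PlusE C l r (InR b) \<doteq> inst r b \<Colon> inst C (InR b)"
| beta_Lam: "\<Gamma> \<turnstile> A \<Colon> Univ i \<Longrightarrow> A # \<Gamma> \<turnstile> B \<Colon> Univ j \<Longrightarrow> A # \<Gamma> \<turnstile> b \<Colon> B \<Longrightarrow>
    \<Gamma> \<turnstile> a \<Colon> A \<Longrightarrow> \<Gamma> \<turnstile> App (Lam A b) a \<doteq> inst b a \<Colon> inst B a"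
| eta_Lam: "\<Gamma> \<turnstile> f \<Colon> Pi A B \<Longrightarrow> \<Gamma> \<turnstile> f \<doteq> Lam A (App (wk f) (Var 0)) \<Colon> Pi A B"
| beta_Pr: "Sig A B # \<Gamma> \<turnstile> C \<Colon> Univ k \<Longrightarrow>
    B # A # \<Gamma> \<turnstile> d \<Colon> sub (Pr (Var 1) (Var 0) \<bullet> (\<lambda>k. Var (k + 2))) C \<Longrightarrow>
    \<Gamma> \<turnstile> a \<Colon> A \<Longrightarrow> \<Gamma> \<turnstile> b \<Colon> inst B a \<Longrightarrow>
    \<Gamma> \<turnstile> SigE C d (Pr a b) \<doteq> sub (b \<bullet> a \<bullet> Var) d \<Colon> inst C (Pr a b)"
| beta_Refl: "Idn (wk (wk A)) (Var 1) (Var 0) # wk A # A # \<Gamma> \<turnstile> C \<Colon> Univ k \<Longrightarrow>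
    A # \<Gamma> \<turnstile> d \<Colon> sub (Refl (Var 0) \<bullet> Var 0 \<bullet> Var 0 \<bullet> (\<lambda>k. Var (k + 1))) C \<Longrightarrow>
    \<Gamma> \<turnstile> a \<Colon> A \<Longrightarrow>
    \<Gamma> \<turnstile> IdE C d a a (Refl a) \<doteq> inst d a \<Colon> sub (Refl a \<bullet> a \<bullet> a \<bullet> Var) C"

| cong_EmptyE: "Empty i # \<Gamma> \<turnstile> C \<doteq> C' \<Colon> Univ k \<Longrightarrow> \<Gamma> \<turnstile> e \<doteq> e' \<Colon> Empty i \<Longrightarrow>
    \<Gamma> \<turnstile> EmptyE C e \<doteq> EmptyE C' e' \<Colon> inst C e"
| cong_UnitE: "Unit i # \<Gamma> \<turnstile> C \<doteq> C' \<Colon> Univ k \<Longrightarrow> \<Gamma> \<turnstile> c \<doteq> c' \<Colon> inst C (Star i) \<Longrightarrow>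
    \<Gamma> \<turnstile> e \<doteq> e' \<Colon> Unit i \<Longrightarrow> \<Gamma> \<turnstile> UnitE C c e \<doteq> UnitE C' c' e' \<Colon> inst C e"
| cong_Succ: "\<Gamma> \<turnstile> n \<doteq> n' \<Colon> Nat i \<Longrightarrow> \<Gamma> \<turnstile> Succ n \<doteq> Succ n' \<Colon> Nat i"
| cong_NatE: "Nat i # \<Gamma> \<turnstile> C \<doteq> C' \<Colon> Univ k \<Longrightarrow> \<Gamma> \<turnstile> z \<doteq> z' \<Colon> inst C (Zero i) \<Longrightarrow>
    C # Nat i # \<Gamma> \<turnstile> s \<doteq> s' \<Colon> sub (Succ (Var 1) \<bullet> (\<lambda>k. Var (k + 2))) C \<Longrightarrow>
    \<Gamma> \<turnstile> n \<doteq> n' \<Colon> Nat i \<Longrightarrow> \<Gamma> \<turnstile> NatE C z s n \<doteq> NatE C' z' s' n' \<Colon> inst C n"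
| cong_Plus: "\<Gamma> \<turnstile> A \<doteq> A' \<Colon> Univ i \<Longrightarrow> \<Gamma> \<turnstile> B \<doteq> B' \<Colon> Univ j \<Longrightarrow>
    \<Gamma> \<turnstile> Plus A B \<doteq> Plus A' B' \<Colon> Univ (max i j)"
| cong_InL: "\<Gamma> \<turnstile> a \<doteq> a' \<Colon> A \<Longrightarrow> \<Gamma> \<turnstile> A \<Colon> Univ i \<Longrightarrow> \<Gamma> \<turnstile> B \<Colon> Univ j \<Longrightarrow>
    \<Gamma> \<turnstile> InL a \<doteq> InL a' \<Colon> Plus A B"
| cong_InR: "\<Gamma> \<turnstile> b \<doteq> b' \<Colon> B \<Longrightarrow> \<Gamma> \<turnstile> A \<Colon> Univ i \<Longrightarrow> \<Gamma> \<turnstile> B \<Colon> Univ j \<Longrightarrow>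
    \<Gamma> \<turnstile> InR b \<doteq> InR b' \<Colon> Plus A B"
| cong_PlusE: "Plus A B # \<Gamma> \<turnstile> C \<doteq> C' \<Colon> Univ k \<Longrightarrow>
    A # \<Gamma> \<turnstile> l \<doteq> l' \<Colon> sub (InL (Var 0) \<bullet> (\<lambda>k. Var (k + 1))) C \<Longrightarrow>
    B # \<Gamma> \<turnstile> r \<doteq> r' \<Colon> sub (InR (Var 0) \<bullet> (\<lambda>k. Var (k + 1))) C \<Longrightarrow>
    \<Gamma> \<turnstile> e \<doteq> e' \<Colon> Plus A B \<Longrightarrow> \<Gamma> \<turnstile> PlusE C l r e \<doteq> PlusE C' l' r' e' \<Colon> inst C e"
| cong_Pi: "\<Gamma> \<turnstile> A \<doteq> A' \<Colon> Univ i \<Longrightarrow> A # \<Gamma> \<turnstile> B \<doteq> B' \<Colon> Univ j \<Longrightarrow>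
    \<Gamma> \<turnstile> Pi A B \<doteq> Pi A' B' \<Colon> Univ (max i j)"
| cong_Lam: "\<Gamma> \<turnstile> A \<doteq> A' \<Colon> Univ i \<Longrightarrow> A # \<Gamma> \<turnstile> B \<Colon> Univ j \<Longrightarrow>
    A # \<Gamma> \<turnstile> b \<doteq> b' \<Colon> B \<Longrightarrow> \<Gamma> \<turnstile> Lam A b \<doteq> Lam A' b' \<Colon> Pi A B"
| cong_App: "\<Gamma> \<turnstile> f \<doteq> f' \<Colon> Pi A B \<Longrightarrow> \<Gamma> \<turnstile> a \<doteq> a' \<Colon> A \<Longrightarrow>
    \<Gamma> \<turnstile> App f a \<doteq> App f' a' \<Colon> inst B a"
| cong_Sig: "\<Gamma> \<turnstile> A \<doteq> A' \<Colon> Univ i \<Longrightarrow> A # \<Gamma> \<turnstile> B \<doteq> B' \<Colon> Univ j \<Longrightarrow>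
    \<Gamma> \<turnstile> Sig A B \<doteq> Sig A' B' \<Colon> Univ (max i j)"
| cong_Pr: "\<Gamma> \<turnstile> A \<Colon> Univ i \<Longrightarrow> A # \<Gamma> \<turnstile> B \<Colon> Univ j \<Longrightarrow> \<Gamma> \<turnstile> a \<doteq> a' \<Colon> A \<Longrightarrow>
    \<Gamma> \<turnstile> b \<doteq> b' \<Colon> inst B a \<Longrightarrow> \<Gamma> \<turnstile> Pr a b \<doteq> Pr a' b' \<Colon> Sig A B"
| cong_SigE: "Sig A B # \<Gamma> \<turnstile> C \<doteq> C' \<Colon> Univ k \<Longrightarrow>
    B # A # \<Gamma> \<turnstile> d \<doteq> d' \<Colon> sub (Pr (Var 1) (Var 0) \<bullet> (\<lambda>k. Var (k + 2))) C \<Longrightarrow>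
    \<Gamma> \<turnstile> p \<doteq> p' \<Colon> Sig A B \<Longrightarrow> \<Gamma> \<turnstile> SigE C d p \<doteq> SigE C' d' p' \<Colon> inst C p"
| cong_Idn: "\<Gamma> \<turnstile> A \<doteq> A' \<Colon> Univ i \<Longrightarrow> \<Gamma> \<turnstile> a \<doteq> a' \<Colon> A \<Longrightarrow> \<Gamma> \<turnstile> b \<doteq> b' \<Colon> A \<Longrightarrow>
    \<Gamma> \<turnstile> Idn A a b \<doteq> Idn A' a' b' \<Colon> Univ i"
| cong_Refl: "\<Gamma> \<turnstile> A \<Colon> Univ i \<Longrightarrow> \<Gamma> \<turnstile> a \<doteq> a' \<Colon> A \<Longrightarrow>
    \<Gamma> \<turnstile> Refl a \<doteq> Refl a' \<Colon> Idn A a a"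
| cong_IdE: "Idn (wk (wk A)) (Var 1) (Var 0) # wk A # A # \<Gamma> \<turnstile> C \<doteq> C' \<Colon> Univ k \<Longrightarrow>
    A # \<Gamma> \<turnstile> d \<doteq> d' \<Colon> sub (Refl (Var 0) \<bullet> Var 0 \<bullet> Var 0 \<bullet> (\<lambda>k. Var (k + 1))) C \<Longrightarrow>
    \<Gamma> \<turnstile> a \<doteq> a' \<Colon> A \<Longrightarrow> \<Gamma> \<turnstile> b \<doteq> b' \<Colon> A \<Longrightarrow> \<Gamma> \<turnstile> p \<doteq> p' \<Colon> Idn A a b \<Longrightarrow>
    \<Gamma> \<turnstile> IdE C d a b p \<doteq> IdE C' d' a' b' p' \<Colon> sub (p \<bullet> b \<bullet> a \<bullet> Var) C"
| cong_Trunc: "\<Gamma> \<turnstile> A \<doteq> A' \<Colon> Univ i \<Longrightarrow> \<Gamma> \<turnstile> Trunc A \<doteq> Trunc A' \<Colon> Univ i"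
| cong_TrIn: "\<Gamma> \<turnstile> A \<doteq> A' \<Colon> Univ i \<Longrightarrow> \<Gamma> \<turnstile> TrIn A \<doteq> TrIn A' \<Colon> arrow A (Trunc A)"
| cong_TrProp: "\<Gamma> \<turnstile> A \<doteq> A' \<Colon> Univ i \<Longrightarrow>
    \<Gamma> \<turnstile> TrProp A \<doteq> TrProp A' \<Colon> is_prop (Trunc A)"
| cong_TrRec: "\<Gamma> \<turnstile> A \<doteq> A' \<Colon> Univ i \<Longrightarrow> \<Gamma> \<turnstile> B \<doteq> B' \<Colon> Univ j \<Longrightarrow>
    \<Gamma> \<turnstile> TrRec A B \<doteq> TrRec A' B'
      \<Colon> arrow (is_prop B) (arrow (arrow A B) (arrow (Trunc A) B))"


section \<open>Embeddings, injectivity, excluded middle and resizing\<close>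

definition fiber :: "tm \<Rightarrow> tm \<Rightarrow> tm \<Rightarrow> tm \<Rightarrow> tm" where
  "fiber A B f b = Sig A (Idn (wk B) (App (wk f) (Var 0)) (wk b))"

definition is_embedding :: "tm \<Rightarrow> tm \<Rightarrow> tm \<Rightarrow> tm" where
  "is_embedding A B f = Pi B (is_prop (fiber (wk A) (wk B) (wk f) (Var 0)))"

definition embedding :: "tm \<Rightarrow> tm \<Rightarrow> tm" where
  "embedding A B = Sig (arrow A B) (is_embedding (wk A) (wk B) (Var 0))"

definition ex :: "tm \<Rightarrow> tm \<Rightarrow> tm" where
  "ex A B = Trunc (Sig A B)"

definition logical_equiv :: "tm \<Rightarrow> tm \<Rightarrow> tm" where
  "logical_equiv A B = times (arrow A B) (arrow B A)"

text \<open>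
  In the innermost scope, \<open>X\<close>, \<open>Y\<close>, \<open>j\<close>, \<open>f\<close> and \<open>g\<close> are the
  variables 4, 3, 2, 1 and 0.
\<close>

definition injective :: "nat \<Rightarrow> nat \<Rightarrow> tm \<Rightarrow> tm" where
  "injective u v D =
     Pi (Univ u) (Pi (Univ v) (Pi (embedding (Var 1) (Var 0)) (Pi (arrow (Var 2) ((wk ^^ 3) D))
       (ex (arrow (Var 2) ((wk ^^ 4) D))
          (homotopy (Var 4) ((wk ^^ 5) D)
             (comp (Var 4) (Var 0) (pr1 (arrow (Var 4) (Var 3)) (Var 2)))
             (Var 1))))))"

definition all_inhabited_injective :: "nat \<Rightarrow> tm" where
  "all_inhabited_injective u = Pi (Univ u) (arrow (Trunc (Var 0)) (injective u u (Var 0)))"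

definition excluded_middle :: "nat \<Rightarrow> tm" where
  "excluded_middle u =
     Pi (Univ u) (arrow (is_prop (Var 0)) (Plus (Var 0) (arrow (Var 0) (Empty u))))"

definition Omega :: "nat \<Rightarrow> tm" where
  "Omega u = Sig (Univ u) (is_prop (Var 0))"

text \<open>\<open>Omega u\<close> is closed, so it needs no weakening under the binder.\<close>

definition Omega_resizing :: "nat \<Rightarrow> tm" where
  "Omega_resizing u = Sig (Univ u) (equiv (Var 0) (Omega u))"

end

theory Submission
  imports Defs
begin

text \<open>
  Excluded middle decides the fibers of an embedding, so a map into an inhabited type extends along
  the embedding: use the given map on the image and a point of the type elsewhere. Conversely, for a
  proposition \<open>P\<close> let \<open>X\<close> be \<open>P + \<parallel>P \<rightarrow> \<zero>\<parallel>\<close>, which is a proposition; the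
  truncation makes this true without function extensionality. The inhabited type \<open>X + \<one>\<close> is
  injective, so \<open>InL\<close> extends along the embedding of \<open>X\<close> into \<open>\<one>\<close>. The value of the
  extension at the point of \<open>\<one>\<close> is either an element of \<open>X\<close>, or it lies in the right
  summand and refutes \<open>X\<close>, which is impossible. As \<open>X\<close> is a proposition, the extension may be
  taken out of the truncation.
\<close>

section \<open>Bidirectional typing rules\<close>

text \<open>
  Derivations are checked by repeating \<open>assumption | rule ty | simp (no_asm)\<close>. In the rules
  \<open>ty\<close> every type that is computed by a substitution is the right-hand side of an equation, so
  that \<open>simp\<close> normalises it before it is matched, and every binder puts the well-formedness of
  the extended context among the assumptions, so that it is derived only once. Numerals have to be
  unfolded to successors for normal forms to be unique.
\<close>

declare arrow_def [simp] times_def [simp] pr1_def [simp] is_prop_def [simp] idfun_def [simp]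
  comp_def [simp] homotopy_def [simp] fiber_def [simp] is_embedding_def [simp]
  embedding_def [simp] ex_def [simp] logical_equiv_def [simp]
  Suc_numeral [simp del]

named_theorems ty

text \<open>Reflexivity for type formers only: these rules solve a premise such as
  \<open>Pi A B = F\<close> by unification once \<open>F\<close> is known, whereas an equation whose
  right-hand side is still a substitution does not match and is left to \<open>simp\<close>.\<close>

lemma type_refls [ty]:
  "Pi A B = Pi A B" "Sig A B = Sig A B" "Plus A B = Plus A B" "Idn A a b = Idn A a b"
  by simp_all

lemma Var_ty [ty]:
  "ctx \<Gamma> \<Longrightarrow> n < length \<Gamma> \<Longrightarrow> T = ren (\<lambda>k. k + Suc n) (\<Gamma> ! n) \<Longrightarrow> \<Gamma> \<turnstile> Var n \<Colon> T"
  by (simp only: ty_Var)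

lemma Univ_ty [ty]: "ctx \<Gamma> \<Longrightarrow> T = Univ (Suc i) \<Longrightarrow> \<Gamma> \<turnstile> Univ i \<Colon> T"
  by (simp only: ty_Univ)

lemma EmptyE_ty [ty]:
  "\<Gamma> \<turnstile> e \<Colon> P \<Longrightarrow> Empty i = P \<Longrightarrow> ctx \<Gamma> \<Longrightarrow> (ctx (Empty i # \<Gamma>) \<Longrightarrow> Empty i # \<Gamma> \<turnstile> C \<Colon> Univ k) \<Longrightarrow>
   T = inst C e \<Longrightarrow> \<Gamma> \<turnstile> EmptyE C e \<Colon> T"
  by (metis ctx_Cons ty_Empty ty_EmptyE)

lemma UnitE_ty [ty]:
  "\<Gamma> \<turnstile> e \<Colon> P \<Longrightarrow> Unit i = P \<Longrightarrow> ctx \<Gamma> \<Longrightarrow> (ctx (Unit i # \<Gamma>) \<Longrightarrow> Unit i # \<Gamma> \<turnstile> C \<Colon> Univ k) \<Longrightarrow>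
   D = inst C (Star i) \<Longrightarrow> \<Gamma> \<turnstile> c \<Colon> D \<Longrightarrow> T = inst C e \<Longrightarrow> \<Gamma> \<turnstile> UnitE C c e \<Colon> T"
  by (metis ctx_Cons ty_Unit ty_UnitE)

lemma Plus_ty [ty]:
  "\<Gamma> \<turnstile> A \<Colon> Univ i \<Longrightarrow> \<Gamma> \<turnstile> B \<Colon> Univ j \<Longrightarrow> T = Univ (max i j) \<Longrightarrow> \<Gamma> \<turnstile> Plus A B \<Colon> T"
  by (simp only: ty_Plus)

lemma PlusE_ty [ty]:
  "\<Gamma> \<turnstile> e \<Colon> P \<Longrightarrow> Plus A B = P \<Longrightarrow> \<Gamma> \<turnstile> A \<Colon> Univ i \<Longrightarrow> \<Gamma> \<turnstile> B \<Colon> Univ j \<Longrightarrow> ctx \<Gamma> \<Longrightarrow>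
   (ctx (Plus A B # \<Gamma>) \<Longrightarrow> Plus A B # \<Gamma> \<turnstile> C \<Colon> Univ k) \<Longrightarrow>
   L = sub (InL (Var 0) \<bullet> (\<lambda>k. Var (k + 1))) C \<Longrightarrow> (ctx (A # \<Gamma>) \<Longrightarrow> A # \<Gamma> \<turnstile> l \<Colon> L) \<Longrightarrow>
   R = sub (InR (Var 0) \<bullet> (\<lambda>k. Var (k + 1))) C \<Longrightarrow> (ctx (B # \<Gamma>) \<Longrightarrow> B # \<Gamma> \<turnstile> r \<Colon> R) \<Longrightarrow>
   T = inst C e \<Longrightarrow> \<Gamma> \<turnstile> PlusE C l r e \<Colon> T"
  by (metis ctx_Cons ty_Plus ty_PlusE)

lemma Pi_ty [ty]:
  "\<Gamma> \<turnstile> A \<Colon> Univ i \<Longrightarrow> ctx \<Gamma> \<Longrightarrow> (ctx (A # \<Gamma>) \<Longrightarrow> A # \<Gamma> \<turnstile> B \<Colon> Univ j) \<Longrightarrow> T = Univ (max i j) \<Longrightarrow>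
   \<Gamma> \<turnstile> Pi A B \<Colon> T"
  by (metis ctx_Cons ty_Pi)

lemma Lam_ty [ty]:
  "\<Gamma> \<turnstile> A \<Colon> Univ i \<Longrightarrow> ctx \<Gamma> \<Longrightarrow> (ctx (A # \<Gamma>) \<Longrightarrow> A # \<Gamma> \<turnstile> b \<Colon> B) \<Longrightarrow>
   (ctx (A # \<Gamma>) \<Longrightarrow> A # \<Gamma> \<turnstile> B \<Colon> Univ j) \<Longrightarrow> \<Gamma> \<turnstile> Lam A b \<Colon> Pi A B"
  by (metis ctx_Cons ty_Lam)

lemma App_ty [ty]:
  "\<Gamma> \<turnstile> f \<Colon> F \<Longrightarrow> Pi A B = F \<Longrightarrow> \<Gamma> \<turnstile> a \<Colon> A \<Longrightarrow> T = inst B a \<Longrightarrow> \<Gamma> \<turnstile> App f a \<Colon> T"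
  by (metis ty_App)

lemma Sig_ty [ty]:
  "\<Gamma> \<turnstile> A \<Colon> Univ i \<Longrightarrow> ctx \<Gamma> \<Longrightarrow> (ctx (A # \<Gamma>) \<Longrightarrow> A # \<Gamma> \<turnstile> B \<Colon> Univ j) \<Longrightarrow> T = Univ (max i j) \<Longrightarrow>
   \<Gamma> \<turnstile> Sig A B \<Colon> T"
  by (metis ctx_Cons ty_Sig)

lemma Pr_ty [ty]:
  "\<Gamma> \<turnstile> A \<Colon> Univ i \<Longrightarrow> ctx \<Gamma> \<Longrightarrow> (ctx (A # \<Gamma>) \<Longrightarrow> A # \<Gamma> \<turnstile> B \<Colon> Univ j) \<Longrightarrow>
   \<Gamma> \<turnstile> a \<Colon> A \<Longrightarrow> B' = inst B a \<Longrightarrow> \<Gamma> \<turnstile> b \<Colon> B' \<Longrightarrow> \<Gamma> \<turnstile> Pr a b \<Colon> Sig A B"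
  by (metis ctx_Cons ty_Pr)

lemma SigE_ty [ty]:
  "\<Gamma> \<turnstile> p \<Colon> P \<Longrightarrow> Sig A B = P \<Longrightarrow> \<Gamma> \<turnstile> A \<Colon> Univ i \<Longrightarrow> ctx \<Gamma> \<Longrightarrow> (ctx (A # \<Gamma>) \<Longrightarrow> A # \<Gamma> \<turnstile> B \<Colon> Univ j) \<Longrightarrow>
   (ctx (Sig A B # \<Gamma>) \<Longrightarrow> Sig A B # \<Gamma> \<turnstile> C \<Colon> Univ k) \<Longrightarrow>
   D = sub (Pr (Var 1) (Var 0) \<bullet> (\<lambda>k. Var (k + 2))) C \<Longrightarrow>
   (ctx (B # A # \<Gamma>) \<Longrightarrow> B # A # \<Gamma> \<turnstile> d \<Colon> D) \<Longrightarrow>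
   T = inst C p \<Longrightarrow> \<Gamma> \<turnstile> SigE C d p \<Colon> T"
  by (metis ctx_Cons ty_Sig ty_SigE)

lemma Idn_ty [ty]:
  "\<Gamma> \<turnstile> A \<Colon> Univ i \<Longrightarrow> \<Gamma> \<turnstile> a \<Colon> A \<Longrightarrow> \<Gamma> \<turnstile> b \<Colon> A \<Longrightarrow> T = Univ i \<Longrightarrow> \<Gamma> \<turnstile> Idn A a b \<Colon> T"
  by (simp only: ty_Idn)

text \<open>The names \<open>A1\<close> and \<open>I\<close> let \<open>simp\<close> normalise the
  weakened types before they enter the context.\<close>

lemma IdE_ty [ty]:
  assumes "\<Gamma> \<turnstile> p \<Colon> P" "Idn A a b = P" "\<Gamma> \<turnstile> A \<Colon> Univ i" "ctx \<Gamma>"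
    and A1: "A1 = wk A" "ctx (A # \<Gamma>) \<Longrightarrow> A # \<Gamma> \<turnstile> A1 \<Colon> Univ i'"
    and A2: "I = Idn (wk A1) (Var 1) (Var 0)" "ctx (A1 # A # \<Gamma>) \<Longrightarrow> A1 # A # \<Gamma> \<turnstile> I \<Colon> Univ i''"
    and C: "ctx (I # A1 # A # \<Gamma>) \<Longrightarrow> I # A1 # A # \<Gamma> \<turnstile> C \<Colon> Univ k"
    and d: "D = sub (Refl (Var 0) \<bullet> Var 0 \<bullet> Var 0 \<bullet> (\<lambda>k. Var (k + 1))) C"
      "ctx (A # \<Gamma>) \<Longrightarrow> A # \<Gamma> \<turnstile> d \<Colon> D"
    and "\<Gamma> \<turnstile> a \<Colon> A" "\<Gamma> \<turnstile> b \<Colon> A" "T = sub (p \<bullet> b \<bullet> a \<bullet> Var) C"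
  shows "\<Gamma> \<turnstile> IdE C d a b p \<Colon> T"
  using assms by (metis ctx_Cons ty_IdE)

lemma Trunc_ty [ty]: "\<Gamma> \<turnstile> A \<Colon> Univ i \<Longrightarrow> T = Univ i \<Longrightarrow> \<Gamma> \<turnstile> Trunc A \<Colon> T"
  by (simp only: ty_Trunc)

lemma TrIn_ty [ty]: "\<Gamma> \<turnstile> A \<Colon> Univ i \<Longrightarrow> T = arrow A (Trunc A) \<Longrightarrow> \<Gamma> \<turnstile> TrIn A \<Colon> T"
  by (simp only: ty_TrIn)

lemma TrProp_ty [ty]: "\<Gamma> \<turnstile> A \<Colon> Univ i \<Longrightarrow> T = is_prop (Trunc A) \<Longrightarrow> \<Gamma> \<turnstile> TrProp A \<Colon> T"
  by (simp only: ty_TrProp)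

lemma TrRec_ty [ty]:
  "\<Gamma> \<turnstile> A \<Colon> Univ i \<Longrightarrow> \<Gamma> \<turnstile> B \<Colon> Univ j \<Longrightarrow>
   T = arrow (is_prop B) (arrow (arrow A B) (arrow (Trunc A) B)) \<Longrightarrow> \<Gamma> \<turnstile> TrRec A B \<Colon> T"
  by (simp only: ty_TrRec)

lemma constants_ty [ty]:
  "ctx \<Gamma> \<Longrightarrow> T = Univ i \<Longrightarrow> \<Gamma> \<turnstile> Empty i \<Colon> T"
  "ctx \<Gamma> \<Longrightarrow> T = Univ i \<Longrightarrow> \<Gamma> \<turnstile> Unit i \<Colon> T"
  "ctx \<Gamma> \<Longrightarrow> T = Unit i \<Longrightarrow> \<Gamma> \<turnstile> Star i \<Colon> T"
  by (simp_all only: ty_Empty ty_Unit ty_Star)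

lemma InL_ty [ty]:
  "\<Gamma> \<turnstile> a \<Colon> A \<Longrightarrow> \<Gamma> \<turnstile> A \<Colon> Univ i \<Longrightarrow> \<Gamma> \<turnstile> B \<Colon> Univ j \<Longrightarrow> \<Gamma> \<turnstile> InL a \<Colon> Plus A B"
  by (fact ty_InL)

lemma InR_ty [ty]:
  "\<Gamma> \<turnstile> b \<Colon> B \<Longrightarrow> \<Gamma> \<turnstile> A \<Colon> Univ i \<Longrightarrow> \<Gamma> \<turnstile> B \<Colon> Univ j \<Longrightarrow> \<Gamma> \<turnstile> InR b \<Colon> Plus A B"
  by (fact ty_InR)

lemma Refl_ty [ty]:
  "\<Gamma> \<turnstile> a \<Colon> A \<Longrightarrow> \<Gamma> \<turnstile> A \<Colon> Univ i \<Longrightarrow> \<Gamma> \<turnstile> Refl a \<Colon> Idn A a a"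
  by (rule ty_Refl)

section \<open>Computation rules and conversion of endpoints\<close>

lemma UnitE_Star_eq:
  "ctx \<Gamma> \<Longrightarrow> (ctx (Unit i # \<Gamma>) \<Longrightarrow> Unit i # \<Gamma> \<turnstile> C \<Colon> Univ k) \<Longrightarrow>
   T = inst C (Star i) \<Longrightarrow> \<Gamma> \<turnstile> c \<Colon> T \<Longrightarrow> \<Gamma> \<turnstile> UnitE C c (Star i) \<doteq> c \<Colon> T"
  by (metis ctx_Cons ty_Unit beta_UnitE)

lemma PlusE_InL_eq:
  "\<Gamma> \<turnstile> a \<Colon> A \<Longrightarrow> \<Gamma> \<turnstile> A \<Colon> Univ i \<Longrightarrow> \<Gamma> \<turnstile> B \<Colon> Univ j \<Longrightarrow> ctx \<Gamma> \<Longrightarrow>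
   (ctx (Plus A B # \<Gamma>) \<Longrightarrow> Plus A B # \<Gamma> \<turnstile> C \<Colon> Univ k) \<Longrightarrow>
   L = sub (InL (Var 0) \<bullet> (\<lambda>k. Var (k + 1))) C \<Longrightarrow> (ctx (A # \<Gamma>) \<Longrightarrow> A # \<Gamma> \<turnstile> l \<Colon> L) \<Longrightarrow>
   R = sub (InR (Var 0) \<bullet> (\<lambda>k. Var (k + 1))) C \<Longrightarrow> (ctx (B # \<Gamma>) \<Longrightarrow> B # \<Gamma> \<turnstile> r \<Colon> R) \<Longrightarrow>
   t = inst l a \<Longrightarrow> T = inst C (InL a) \<Longrightarrow> \<Gamma> \<turnstile> PlusE C l r (InL a) \<doteq> t \<Colon> T"
  by (metis ctx_Cons ty_Plus beta_InL)

lemma PlusE_InR_eq: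
  "\<Gamma> \<turnstile> b \<Colon> B \<Longrightarrow> \<Gamma> \<turnstile> A \<Colon> Univ i \<Longrightarrow> \<Gamma> \<turnstile> B \<Colon> Univ j \<Longrightarrow> ctx \<Gamma> \<Longrightarrow>
   (ctx (Plus A B # \<Gamma>) \<Longrightarrow> Plus A B # \<Gamma> \<turnstile> C \<Colon> Univ k) \<Longrightarrow>
   L = sub (InL (Var 0) \<bullet> (\<lambda>k. Var (k + 1))) C \<Longrightarrow> (ctx (A # \<Gamma>) \<Longrightarrow> A # \<Gamma> \<turnstile> l \<Colon> L) \<Longrightarrow>
   R = sub (InR (Var 0) \<bullet> (\<lambda>k. Var (k + 1))) C \<Longrightarrow> (ctx (B # \<Gamma>) \<Longrightarrow> B # \<Gamma> \<turnstile> r \<Colon> R) \<Longrightarrow>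
   t = inst r b \<Longrightarrow> T = inst C (InR b) \<Longrightarrow> \<Gamma> \<turnstile> PlusE C l r (InR b) \<doteq> t \<Colon> T"
  by (metis ctx_Cons ty_Plus beta_InR)

lemma App_Lam_eq:
  "\<Gamma> \<turnstile> A \<Colon> Univ i \<Longrightarrow> ctx \<Gamma> \<Longrightarrow> (ctx (A # \<Gamma>) \<Longrightarrow> A # \<Gamma> \<turnstile> b \<Colon> B) \<Longrightarrow>
   (ctx (A # \<Gamma>) \<Longrightarrow> A # \<Gamma> \<turnstile> B \<Colon> Univ j) \<Longrightarrow> \<Gamma> \<turnstile> a \<Colon> A \<Longrightarrow> t = inst b a \<Longrightarrow> T = inst B a \<Longrightarrow>
   \<Gamma> \<turnstile> App (Lam A b) a \<doteq> t \<Colon> T"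
  by (metis ctx_Cons beta_Lam)

lemma SigE_Pr_eq:
  "\<Gamma> \<turnstile> A \<Colon> Univ i \<Longrightarrow> ctx \<Gamma> \<Longrightarrow> (ctx (A # \<Gamma>) \<Longrightarrow> A # \<Gamma> \<turnstile> B \<Colon> Univ j) \<Longrightarrow>
   (ctx (Sig A B # \<Gamma>) \<Longrightarrow> Sig A B # \<Gamma> \<turnstile> C \<Colon> Univ k) \<Longrightarrow>
   D = sub (Pr (Var 1) (Var 0) \<bullet> (\<lambda>k. Var (k + 2))) C \<Longrightarrow>
   (ctx (B # A # \<Gamma>) \<Longrightarrow> B # A # \<Gamma> \<turnstile> d \<Colon> D) \<Longrightarrow>
   \<Gamma> \<turnstile> a \<Colon> A \<Longrightarrow> B' = inst B a \<Longrightarrow> \<Gamma> \<turnstile> b \<Colon> B' \<Longrightarrow>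
   t = sub (b \<bullet> a \<bullet> Var) d \<Longrightarrow> T = inst C (Pr a b) \<Longrightarrow> \<Gamma> \<turnstile> SigE C d (Pr a b) \<doteq> t \<Colon> T"
  by (metis ctx_Cons ty_Sig beta_Pr)

lemma cong_App_eq:
  "\<Gamma> \<turnstile> f \<doteq> f' \<Colon> F \<Longrightarrow> Pi A B = F \<Longrightarrow> \<Gamma> \<turnstile> a \<doteq> a' \<Colon> A \<Longrightarrow> T = inst B a \<Longrightarrow>
   \<Gamma> \<turnstile> App f a \<doteq> App f' a' \<Colon> T"
  by (metis cong_App)

text \<open>Apart from the codes of sums below, judgemental equality enters the typing of proof
  terms only through this change of endpoints.\<close>

lemma Idn_conv:
  "\<Gamma> \<turnstile> p \<Colon> P \<Longrightarrow> Idn A a b = P \<Longrightarrow> \<Gamma> \<turnstile> A \<Colon> Univ i \<Longrightarrow> \<Gamma> \<turnstile> a \<doteq> a' \<Colon> A \<Longrightarrow>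
   \<Gamma> \<turnstile> b \<doteq> b' \<Colon> A \<Longrightarrow> \<Gamma> \<turnstile> p \<Colon> Idn A a' b'"
  by (meson cong_Idn eq_refl ty_conv)

section \<open>Types of the statement\<close>

lemma Omega_resizing_ty [ty]:
  "ctx \<Gamma> \<Longrightarrow> T = Univ (Suc u) \<Longrightarrow> \<Gamma> \<turnstile> Omega_resizing u \<Colon> T"
  apply hypsubst
  apply (simp add: Omega_resizing_def equiv_def is_equiv_def Omega_def eval_nat_numeral)
  apply (assumption | rule ty | simp (no_asm))+
  done

lemma excluded_middle_ty [ty]:
  "ctx \<Gamma> \<Longrightarrow> T = Univ (Suc u) \<Longrightarrow> \<Gamma> \<turnstile> excluded_middle u \<Colon> T"
  apply hypsubst
  apply (simp add: excluded_middle_def eval_nat_numeral)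
  apply (assumption | rule ty | simp (no_asm))+
  done

lemma all_inhabited_injective_ty [ty]:
  "ctx \<Gamma> \<Longrightarrow> T = Univ (Suc u) \<Longrightarrow> \<Gamma> \<turnstile> all_inhabited_injective u \<Colon> T"
  apply hypsubst
  apply (simp add: all_inhabited_injective_def injective_def eval_nat_numeral)
  apply (assumption | rule ty | simp (no_asm))+
  done

text \<open>Being fixed by renaming and substitution, these types can stay folded in later
  derivations.\<close>

lemma closed_types [simp]:
  "ren \<xi> (excluded_middle u) = excluded_middle u"
  "sub \<sigma> (excluded_middle u) = excluded_middle u"
  "ren \<xi> (all_inhabited_injective u) = all_inhabited_injective u"
  "sub \<sigma> (all_inhabited_injective u) = all_inhabited_injective u"
  by (simp_all add: all_inhabited_injective_def excluded_middle_def injective_def eval_nat_numeral)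

section \<open>Propositions, the unit type and sums\<close>

definition empty_prop :: "nat \<Rightarrow> tm" where
  "empty_prop u = Lam (Empty u) (EmptyE (Pi (Empty u) (Idn (Empty u) (Var 1) (Var 0))) (Var 0))"

lemma empty_prop_ty [ty]:
  "ctx \<Gamma> \<Longrightarrow> T = is_prop (Empty u) \<Longrightarrow> \<Gamma> \<turnstile> empty_prop u \<Colon> T"
  apply hypsubst
  apply (simp add: empty_prop_def eval_nat_numeral)
  apply (assumption | rule ty | simp (no_asm))+
  done

lemma empty_prop_closed [simp]:
  "ren \<xi> (empty_prop u) = empty_prop u" "sub \<sigma> (empty_prop u) = empty_prop u"
  by (simp_all add: empty_prop_def)

text \<open>
  A path between any two elements that is reflexivity on the diagonal. Path induction identifies
  every path with it, so the unit type is a set.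
\<close>

definition unit_canon :: "nat \<Rightarrow> tm \<Rightarrow> tm \<Rightarrow> tm" where [simp]:
  "unit_canon u a b =
     UnitE (Idn (Unit u) (Var 0) (wk b)) (UnitE (Idn (Unit u) (Star u) (Var 0)) (Refl (Star u)) b) a"

lemma unit_canon_Star:
  assumes "ctx \<Gamma>"
  shows "\<Gamma> \<turnstile> unit_canon u (Star u) (Star u) \<doteq> Refl (Star u) \<Colon> Idn (Unit u) (Star u) (Star u)"
  unfolding unit_canon_def
  apply (rule eq_trans)
  using assms by - (assumption | rule ty UnitE_Star_eq | simp (no_asm))+

text \<open>Base case of \<open>unit_path\<close>: the canonical path at \<open>Star u\<close>
  computes to \<open>Refl (Star u)\<close>.\<close>

lemma Refl_unit_canon_Star:
  assumes "ctx \<Gamma>"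
  shows "\<Gamma> \<turnstile> Refl (Refl (Star u))
    \<Colon> Idn (Idn (Unit u) (Star u) (Star u)) (unit_canon u (Star u) (Star u)) (Refl (Star u))"
  apply (rule Idn_conv[OF _ _ _ eq_sym[OF unit_canon_Star[OF assms]] eq_refl])
  using assms by - (assumption | rule ty | simp (no_asm))+

text \<open>Path induction leaves a single point, and eliminating it reduces the claim to
  \<open>Star u\<close>.\<close>

definition unit_path :: "nat \<Rightarrow> tm" where
  "unit_path u = Lam (Unit u) (Lam (Unit u) (Lam (Idn (Unit u) (Var 1) (Var 0))
     (IdE (Idn (Idn (Unit u) (Var 2) (Var 1)) (unit_canon u (Var 2) (Var 1)) (Var 0))
       (UnitE (Idn (Idn (Unit u) (Var 0) (Var 0)) (unit_canon u (Var 0) (Var 0)) (Refl (Var 0)))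
          (Refl (Refl (Star u))) (Var 0))
       (Var 2) (Var 1) (Var 0))))"

lemma unit_path_ty [ty]:
  "ctx \<Gamma> \<Longrightarrow> T = Pi (Unit u) (Pi (Unit u) (Pi (Idn (Unit u) (Var 1) (Var 0))
     (Idn (Idn (Unit u) (Var 2) (Var 1)) (unit_canon u (Var 2) (Var 1)) (Var 0)))) \<Longrightarrow>
   \<Gamma> \<turnstile> unit_path u \<Colon> T"
  apply hypsubst
  apply (simp add: unit_path_def eval_nat_numeral)
  apply (assumption | rule Refl_unit_canon_Star[simplified] ty | simp (no_asm))+
  done

lemma unit_path_closed [simp]:
  "ren \<xi> (unit_path u) = unit_path u" "sub \<sigma> (unit_path u) = unit_path u"
  by (simp_all add: unit_path_def)

text \<open>Two paths \<open>p\<close> and \<open>q\<close> both equal the canonical one. Induction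
  along the path from the canonical one to \<open>p\<close>, with a function type as motive, turns
  canonical = \<open>q\<close> into \<open>p\<close> = \<open>q\<close>; this does the work of
  symmetry and transitivity.\<close>

definition unit_set :: "nat \<Rightarrow> tm" where
  "unit_set u = Lam (Unit u) (Lam (Unit u) (Lam (Idn (Unit u) (Var 1) (Var 0))
     (Lam (Idn (Unit u) (Var 2) (Var 1))
       (App (IdE
         (arrow (Idn (Idn (Unit u) (Var 6) (Var 5)) (Var 2) (Var 3))
           (Idn (Idn (Unit u) (Var 6) (Var 5)) (Var 1) (Var 3)))
         (Lam (Idn (Idn (Unit u) (Var 4) (Var 3)) (Var 0) (Var 1)) (Var 0))
         (unit_canon u (Var 3) (Var 2)) (Var 1)
         (App (App (App (unit_path u) (Var 3)) (Var 2)) (Var 1)))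
       (App (App (App (unit_path u) (Var 3)) (Var 2)) (Var 0))))))"

lemma unit_set_ty [ty]:
  "ctx \<Gamma> \<Longrightarrow> T = Pi (Unit u) (Pi (Unit u) (is_prop (Idn (Unit u) (Var 1) (Var 0)))) \<Longrightarrow>
   \<Gamma> \<turnstile> unit_set u \<Colon> T"
  apply hypsubst
  apply (simp add: unit_set_def eval_nat_numeral)
  apply (assumption | rule ty | simp (no_asm))+
  done

lemma unit_set_closed [simp]: "ren \<xi> (unit_set u) = unit_set u" "sub \<sigma> (unit_set u) = unit_set u"
  by (simp_all add: unit_set_def)

section \<open>Disjointness of the summands\<close>

text \<open>Large elimination into the universe: transport along a path from \<open>InR b\<close> to
  \<open>InL a\<close> would carry \<open>Star u\<close> into \<open>Empty u\<close>.\<close>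

definition code :: "nat \<Rightarrow> tm \<Rightarrow> tm" where [simp]:
  "code u e = PlusE (Univ u) (Empty u) (Unit u) e"

lemma code_InL:
  assumes "\<Gamma> \<turnstile> a \<Colon> A" "\<Gamma> \<turnstile> A \<Colon> Univ u" "ctx \<Gamma>" "\<Gamma> \<turnstile> t \<Colon> code u (InL a)"
  shows "\<Gamma> \<turnstile> t \<Colon> Empty u"
proof -
  have "\<Gamma> \<turnstile> code u (InL a) \<doteq> Empty u \<Colon> Univ u"
    unfolding code_def using assms(3)
    \<comment> \<open>The term \<open>code u (InL a)\<close> does not record the sum it eliminates,
      so any type may serve as the right summand.\<close>
    by - (rule PlusE_InL_eq[where B = "Unit u"] assms | assumption | rule ty | simp (no_asm))+
  with assms(4) show ?thesis by (rule ty_conv)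
qed

lemma code_InR:
  assumes "\<Gamma> \<turnstile> b \<Colon> B" "\<Gamma> \<turnstile> B \<Colon> Univ u" "ctx \<Gamma>" "\<Gamma> \<turnstile> t \<Colon> Unit u"
  shows "\<Gamma> \<turnstile> t \<Colon> code u (InR b)"
proof -
  have "\<Gamma> \<turnstile> code u (InR b) \<doteq> Unit u \<Colon> Univ u"
    unfolding code_def using assms(3)
    by - (rule PlusE_InR_eq[where A = "Unit u"] assms | assumption | rule ty | simp (no_asm))+
  with assms(4) show ?thesis by (blast intro: ty_conv eq_sym)
qed

definition noconf :: "nat \<Rightarrow> tm" where
  "noconf u = Lam (Univ u) (Lam (Univ u) (Lam (Var 1) (Lam (Var 1)
    (Lam (Idn (Plus (Var 3) (Var 2)) (InR (Var 0)) (InL (Var 1)))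
     (App (IdE (arrow (code u (Var 2)) (code u (Var 1))) (Lam (code u (Var 0)) (Var 0))
         (InR (Var 1)) (InL (Var 2)) (Var 0))
       (Star u))))))"

lemma noconf_ty [ty]:
  "ctx \<Gamma> \<Longrightarrow> T = Pi (Univ u) (Pi (Univ u) (Pi (Var 1) (Pi (Var 1)
    (arrow (Idn (Plus (Var 3) (Var 2)) (InR (Var 0)) (InL (Var 1))) (Empty u))))) \<Longrightarrow>
   \<Gamma> \<turnstile> noconf u \<Colon> T"
  apply hypsubst
  apply (simp add: noconf_def eval_nat_numeral)
  \<comment> \<open>The term \<open>t\<close> is fixed so that \<open>code_InL\<close> is not tried
    on every term of type \<open>Empty u\<close>; \<open>a\<close> does not occur in its conclusion
    and has to be supplied.\<close>
  apply (assumption |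
    rule code_InL[where t = "App f (Star u)" and a = "Var (Suc (Suc 0))" for f, simplified]
    code_InR[where t = "Star u", simplified] ty | simp (no_asm))+
  done

lemma noconf_closed [simp]: "ren \<xi> (noconf u) = noconf u" "sub \<sigma> (noconf u) = noconf u"
  by (simp_all add: noconf_def)

section \<open>The sum of a proposition and its truncated negation\<close>

definition decision :: "nat \<Rightarrow> tm \<Rightarrow> tm" where [simp]:
  "decision u P = Plus P (Trunc (arrow P (Empty u)))"

text \<open>The truncated negation \<open>t\<close> can be eliminated against \<open>p\<close>
  because the target \<open>Empty u\<close> is a proposition.\<close>

definition absurd :: "nat \<Rightarrow> tm \<Rightarrow> tm \<Rightarrow> tm \<Rightarrow> tm" where [simp]:
  "absurd u P p t =
     App (App (App (TrRec (arrow P (Empty u)) (Empty u)) (empty_prop u))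
       (Lam (arrow P (Empty u)) (App (Var 0) (wk p)))) t"

text \<open>Case split on both elements. Within one summand, path induction maps a path of the
  summand to one between the injections; the mixed cases are contradictory by
  \<open>absurd\<close>.\<close>

definition decision_prop :: "nat \<Rightarrow> tm" where
  "decision_prop u =
     Lam (Univ u) (Lam (is_prop (Var 0)) (Lam (decision u (Var 1))
       (PlusE (Pi (decision u (Var 3)) (Idn (decision u (Var 4)) (Var 1) (Var 0)))
         (Lam (decision u (Var 3))
           (PlusE (Idn (decision u (Var 5)) (InL (Var 2)) (Var 0))
             (IdE (Idn (decision u (Var 8)) (InL (Var 2)) (InL (Var 1))) (Refl (InL (Var 0)))
               (Var 2) (Var 0) (App (App (Var 4) (Var 2)) (Var 0)))
             (EmptyE (Idn (decision u (Var 6)) (InL (Var 3)) (InR (Var 1)))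
               (absurd u (Var 5) (Var 2) (Var 0)))
             (Var 0)))
         (Lam (decision u (Var 3))
           (PlusE (Idn (decision u (Var 5)) (InR (Var 2)) (Var 0))
             (EmptyE (Idn (decision u (Var 6)) (InR (Var 3)) (InL (Var 1)))
               (absurd u (Var 5) (Var 0) (Var 2)))
             (IdE (Idn (decision u (Var 8)) (InR (Var 2)) (InR (Var 1))) (Refl (InR (Var 0)))
               (Var 2) (Var 0) (App (App (TrProp (arrow (Var 5) (Empty u))) (Var 2)) (Var 0)))
             (Var 0)))
         (Var 0))))"

lemma decision_prop_ty [ty]:
  "ctx \<Gamma> \<Longrightarrow>
   T = Pi (Univ u) (arrow (is_prop (Var 0)) (is_prop (decision u (Var 0)))) \<Longrightarrow>
   \<Gamma> \<turnstile> decision_prop u \<Colon> T"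
  apply hypsubst
  apply (simp add: decision_prop_def eval_nat_numeral)
  apply (assumption | rule ty | simp (no_asm))+
  done

lemma decision_prop_closed [simp]:
  "ren \<xi> (decision_prop u) = decision_prop u" "sub \<sigma> (decision_prop u) = decision_prop u"
  by (simp_all add: decision_prop_def eval_nat_numeral)

section \<open>A proposition embeds into the unit type\<close>

definition to_unit :: "nat \<Rightarrow> tm \<Rightarrow> tm" where [simp]:
  "to_unit u A = Lam A (Star u)"

definition unit_fiber :: "nat \<Rightarrow> tm \<Rightarrow> tm \<Rightarrow> tm" where [simp]:
  "unit_fiber u A y = fiber A (Unit u) (to_unit u A) y"

text \<open>Two fiber elements have equal first components, as the domain is a proposition. The
  motive of the outer \<open>IdE\<close> quantifies over both second components, so that after
  induction they are parallel paths in the unit type, equal by \<open>unit_set\<close>.\<close>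

definition prop_embedding :: "nat \<Rightarrow> tm" where
  "prop_embedding u =
     Lam (Univ u) (Lam (is_prop (Var 0)) (Lam (Unit u) (Lam (unit_fiber u (Var 2) (Var 0))
       (SigE (Pi (unit_fiber u (Var 4) (Var 2)) (Idn (unit_fiber u (Var 5) (Var 3)) (Var 1) (Var 0)))
         (Lam (unit_fiber u (Var 5) (Var 3))
           (SigE (Idn (unit_fiber u (Var 7) (Var 5)) (Pr (Var 3) (Var 2)) (Var 0))
             (App (App
               (IdE
                 (Pi (Idn (Unit u) (App (to_unit u (Var 11)) (Var 2)) (Var 9))
                   (Pi (Idn (Unit u) (App (to_unit u (Var 12)) (Var 2)) (Var 10))
                     (Idn (unit_fiber u (Var 13) (Var 11)) (Pr (Var 4) (Var 1)) (Pr (Var 3) (Var 0)))))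
                 (Lam (Idn (Unit u) (App (to_unit u (Var 9)) (Var 0)) (Var 7))
                   (Lam (Idn (Unit u) (App (to_unit u (Var 10)) (Var 1)) (Var 8))
                     (IdE (Idn (unit_fiber u (Var 14) (Var 12)) (Pr (Var 5) (Var 2)) (Pr (Var 5) (Var 1)))
                       (Refl (Pr (Var 3) (Var 0)))
                       (Var 1) (Var 0)
                       (App (App (App (App (unit_set u) (App (to_unit u (Var 11)) (Var 2)))
                         (Var 9)) (Var 1)) (Var 0)))))
                 (Var 4) (Var 1) (App (App (Var 7) (Var 4)) (Var 1)))
               (Var 3)) (Var 0))
             (Var 0)))
         (Var 0)))))"

lemma prop_embedding_ty [ty]:
  "ctx \<Gamma> \<Longrightarrow>
   T = Pi (Univ u) (arrow (is_prop (Var 0)) (is_embedding (Var 0) (Unit u) (to_unit u (Var 0)))) \<Longrightarrow>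
   \<Gamma> \<turnstile> prop_embedding u \<Colon> T"
  apply hypsubst
  apply (simp add: prop_embedding_def eval_nat_numeral)
  apply (assumption | rule ty | simp (no_asm))+
  done

lemma prop_embedding_closed [simp]:
  "ren \<xi> (prop_embedding u) = prop_embedding u" "sub \<sigma> (prop_embedding u) = prop_embedding u"
  by (simp_all add: prop_embedding_def eval_nat_numeral)

section \<open>From injectivity to excluded middle\<close>

text \<open>
  The type of a pair cannot be inferred; under the first projection the second component is known to
  be a proof that the first one is an embedding. Likewise below, where the other summand in the
  codomain of \<open>InL\<close> is known to be the unit type.
\<close>

lemma pr1_embedding_ty:
  assumes "\<Gamma> \<turnstile> a \<Colon> F" "Pi X Y = F" "B = is_embedding (wk X) Y (Var 0)" "\<Gamma> \<turnstile> F \<Colon> Univ i" "ctx \<Gamma>"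
    "ctx (F # \<Gamma>) \<Longrightarrow> F # \<Gamma> \<turnstile> B \<Colon> Univ j" "B' = inst B a" "\<Gamma> \<turnstile> b \<Colon> B'"
    "ctx (Sig F B # \<Gamma>) \<Longrightarrow> Sig F B # \<Gamma> \<turnstile> C \<Colon> Univ k"
    "D = sub (Pr (Var 1) (Var 0) \<bullet> (\<lambda>k. Var (k + 2))) C"
    "ctx (B # F # \<Gamma>) \<Longrightarrow> B # F # \<Gamma> \<turnstile> Var (Suc 0) \<Colon> D" "T = inst C (Pr a b)"
  shows "\<Gamma> \<turnstile> SigE C (Var (Suc 0)) (Pr a b) \<Colon> T"
  by (rule SigE_ty[OF Pr_ty[OF assms(4,5,6,1,7,8)] refl assms(4,5,6,9-12)])

lemma pr1_embedding_eq:
  assumes "\<Gamma> \<turnstile> a \<Colon> F" "Pi X Y = F" "B = is_embedding (wk X) Y (Var 0)" "\<Gamma> \<turnstile> F \<Colon> Univ i" "ctx \<Gamma>"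
    "ctx (F # \<Gamma>) \<Longrightarrow> F # \<Gamma> \<turnstile> B \<Colon> Univ j" "B' = inst B a" "\<Gamma> \<turnstile> b \<Colon> B'"
    "ctx (Sig F B # \<Gamma>) \<Longrightarrow> Sig F B # \<Gamma> \<turnstile> C \<Colon> Univ k"
    "D = sub (Pr (Var 1) (Var 0) \<bullet> (\<lambda>k. Var (k + 2))) C"
    "ctx (B # F # \<Gamma>) \<Longrightarrow> B # F # \<Gamma> \<turnstile> Var (Suc 0) \<Colon> D" "T = inst C (Pr a b)"
  shows "\<Gamma> \<turnstile> SigE C (Var (Suc 0)) (Pr a b) \<doteq> a \<Colon> T"
  by (rule SigE_Pr_eq[where t = a, OF assms(4,5,6,9-11,1,7,8) _ assms(12)]) simp_all

lemma Lam_InL_ty: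
  "\<Gamma> \<turnstile> A \<Colon> Univ i \<Longrightarrow> ctx \<Gamma> \<Longrightarrow> A' = wk A \<Longrightarrow> (ctx (A # \<Gamma>) \<Longrightarrow> A # \<Gamma> \<turnstile> A' \<Colon> Univ j) \<Longrightarrow>
   (ctx (A # \<Gamma>) \<Longrightarrow> A # \<Gamma> \<turnstile> Var 0 \<Colon> A') \<Longrightarrow> T = Pi A (Plus A' (Unit u)) \<Longrightarrow>
   \<Gamma> \<turnstile> Lam A (InL (Var 0)) \<Colon> T"
  by (metis ctx_Cons ty_InL ty_Lam ty_Plus ty_Unit)

lemma App_Lam_InL_eq:
  "\<Gamma> \<turnstile> A \<Colon> Univ i \<Longrightarrow> ctx \<Gamma> \<Longrightarrow> A' = wk A \<Longrightarrow> (ctx (A # \<Gamma>) \<Longrightarrow> A # \<Gamma> \<turnstile> A' \<Colon> Univ j) \<Longrightarrow>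
   (ctx (A # \<Gamma>) \<Longrightarrow> A # \<Gamma> \<turnstile> Var 0 \<Colon> A') \<Longrightarrow> \<Gamma> \<turnstile> a \<Colon> A \<Longrightarrow> T = inst (Plus A' (Unit u)) a \<Longrightarrow>
   \<Gamma> \<turnstile> App (Lam A (InL (Var 0))) a \<doteq> InL a \<Colon> T"
  by (rule App_Lam_eq[of _ A i _ "Plus A' (Unit u)" "max j u"])
    (auto intro: ty_InL ty_Plus ty_Unit)

section \<open>Extending the left injection along the embedding into the unit type\<close>

definition unit_embedding :: "nat \<Rightarrow> tm \<Rightarrow> tm \<Rightarrow> tm" where [simp]:
  "unit_embedding u A h = Pr (to_unit u A) (App (App (prop_embedding u) A) h)"

definition extends_InL :: "nat \<Rightarrow> tm \<Rightarrow> tm \<Rightarrow> tm \<Rightarrow> tm" where [simp]: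
  "extends_InL u A h g = homotopy A (Plus A (Unit u))
     (comp A g (pr1 (arrow A (Unit u)) (unit_embedding u A h))) (Lam A (InL (Var 0)))"

definition ext_at_star :: "nat \<Rightarrow> tm" where
  "ext_at_star u = Lam (Univ u) (Lam (is_prop (Var 0)) (Lam (arrow (Unit u) (Plus (Var 1) (Unit u)))
     (Lam (extends_InL u (Var 2) (Var 1) (Var 0)) (Lam (Var 3) (App (Var 1) (Var 0))))))"

text \<open>The embedding is constantly \<open>Star u\<close>, so both ends of the homotopy at a
  point compute to the stated ones.\<close>

lemma extends_InL_conv:
  fixes u \<Gamma>
  defines "\<Delta> \<equiv> Var 3 # extends_InL u (Var 2) (Var 1) (Var 0) # arrow (Unit u) (Plus (Var 1) (Unit u)) #
    is_prop (Var 0) # Univ u # \<Gamma>"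
  assumes "ctx \<Delta>"
  shows "\<Delta> \<turnstile> App (Var 1) (Var 0) \<Colon> Idn (Plus (Var 4) (Unit u)) (App (Var 2) (Star u)) (InL (Var 0))"
  using assms(2) unfolding \<Delta>_def
  apply (simp add: eval_nat_numeral)
  apply (rule Idn_conv)
  apply (assumption | rule pr1_embedding_ty Lam_InL_ty[of _ _ _ _ _ _ u] ty | simp (no_asm))+
  \<comment> \<open>Left end: beta for the composite, then, in the argument of the extension,
    projection of the embedding and beta for \<open>to_unit\<close>.\<close>
  apply (rule eq_trans, rule App_Lam_eq)
  apply (assumption | rule pr1_embedding_ty Lam_InL_ty[of _ _ _ _ _ _ u] ty | simp (no_asm))+
  apply (rule cong_App_eq)
  apply (rule eq_refl)
  apply (assumption | rule pr1_embedding_ty Lam_InL_ty[of _ _ _ _ _ _ u] ty | simp (no_asm))+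
  apply (rule eq_trans)
  apply (rule cong_App_eq)
  apply (rule pr1_embedding_eq)
  apply (assumption | rule pr1_embedding_ty Lam_InL_ty[of _ _ _ _ _ _ u] ty | simp (no_asm))+
  apply (rule eq_refl)
  apply (assumption | rule pr1_embedding_ty Lam_InL_ty[of _ _ _ _ _ _ u] ty | simp (no_asm))+
  apply (rule App_Lam_eq)
  apply (assumption | rule pr1_embedding_ty Lam_InL_ty[of _ _ _ _ _ _ u] ty | simp (no_asm))+
  \<comment> \<open>Right end: beta for the left injection.\<close>
  apply (rule App_Lam_InL_eq)
  apply (assumption | rule pr1_embedding_ty Lam_InL_ty[of _ _ _ _ _ _ u] ty | simp (no_asm))+
  done

lemma ext_at_star_ty [ty]:
  "ctx \<Gamma> \<Longrightarrow>
   T = Pi (Univ u) (Pi (is_prop (Var 0)) (Pi (arrow (Unit u) (Plus (Var 1) (Unit u)))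
     (arrow (extends_InL u (Var 2) (Var 1) (Var 0))
       (Pi (Var 2) (Idn (Plus (Var 3) (Unit u)) (App (Var 1) (Star u)) (InL (Var 0))))))) \<Longrightarrow>
   \<Gamma> \<turnstile> ext_at_star u \<Colon> T"
  apply hypsubst
  apply (simp add: ext_at_star_def eval_nat_numeral)
  apply (assumption | rule extends_InL_conv[unfolded eval_nat_numeral BitM.simps, simplified]
    pr1_embedding_ty Lam_InL_ty[of _ _ _ _ _ _ u] ty | simp (no_asm))+
  done

lemma ext_at_star_closed [simp]:
  "ren \<xi> (ext_at_star u) = ext_at_star u" "sub \<sigma> (ext_at_star u) = ext_at_star u"
  by (simp_all add: ext_at_star_def eval_nat_numeral)

text \<open>The truncation is eliminated into the type itself, a proposition. The value at
  \<open>Star u\<close> is generalised to any element of the sum that equals every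
  \<open>InL x\<close>. In the left case it contains the result; in the right case
  \<open>noconf\<close> refutes the type, and the third argument turns the refutation into an
  element.\<close>

definition injective_retract :: "nat \<Rightarrow> tm" where
  "injective_retract u =
     Lam (Univ u) (Lam (is_prop (Var 0)) (Lam (arrow (arrow (Var 1) (Empty u)) (Var 1))
       (Lam (injective u u (Plus (Var 2) (Unit u)))
         (App (App (App
           (TrRec (Sig (arrow (Unit u) (Plus (Var 3) (Unit u))) (extends_InL u (Var 4) (Var 3) (Var 0))) (Var 3))
           (Var 2))
           (Lam (Sig (arrow (Unit u) (Plus (Var 3) (Unit u))) (extends_InL u (Var 4) (Var 3) (Var 0)))
             (SigE (Var 5)
               (App
                 (PlusE
                   (arrow (Pi (Var 7) (Idn (Plus (Var 8) (Unit u)) (Var 1) (InL (Var 0)))) (Var 7))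
                   (Lam (Pi (Var 7) (Idn (Plus (Var 8) (Unit u)) (InL (Var 1)) (InL (Var 0)))) (Var 1))
                   (Lam (Pi (Var 7) (Idn (Plus (Var 8) (Unit u)) (InR (Var 1)) (InL (Var 0))))
                     (App (Var 6) (Lam (Var 8)
                       (App (App (App (App (App (noconf u) (Var 9)) (Unit u)) (Var 0)) (Var 2))
                         (App (Var 1) (Var 0))))))
                   (App (Var 1) (Star u)))
                 (App (App (App (App (ext_at_star u) (Var 6)) (Var 5)) (Var 1)) (Var 0)))
               (Var 0))))
           (App (App (App (App (Var 0) (Var 3)) (Unit u)) (unit_embedding u (Var 3) (Var 2)))
             (Lam (Var 3) (InL (Var 0))))))))"

lemma injective_retract_ty [ty]:
  "ctx \<Gamma> \<Longrightarrow>
   T = Pi (Univ u) (arrow (is_prop (Var 0)) (arrow (arrow (arrow (Var 0) (Empty u)) (Var 0))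
     (arrow (injective u u (Plus (Var 0) (Unit u))) (Var 0)))) \<Longrightarrow>
   \<Gamma> \<turnstile> injective_retract u \<Colon> T"
  apply hypsubst
  apply (simp add: injective_retract_def injective_def eval_nat_numeral)
  apply (assumption | rule pr1_embedding_ty Lam_InL_ty[of _ _ _ _ _ _ u] ty | simp (no_asm))+
  done

lemma injective_retract_closed [simp]:
  "ren \<xi> (injective_retract u) = injective_retract u"
  "sub \<sigma> (injective_retract u) = injective_retract u"
  by (simp_all add: injective_retract_def injective_def eval_nat_numeral)

text \<open>The retraction is applied to \<open>decision u P\<close>: a refutation of this type
  refutes \<open>P\<close> through \<open>InL\<close>, hence yields its right summand. The resulting
  truncated negation gives a negation by \<open>absurd\<close>.\<close>

definition injective_imp_em :: "nat \<Rightarrow> tm" where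
  "injective_imp_em u =
     Lam (all_inhabited_injective u) (Lam (Univ u) (Lam (is_prop (Var 0))
       (PlusE (Plus (Var 2) (arrow (Var 2) (Empty u)))
         (InL (Var 0))
         (InR (Lam (Var 2) (absurd u (Var 3) (Var 0) (Var 1))))
         (App (App (App (App (injective_retract u) (decision u (Var 1)))
           (App (App (decision_prop u) (Var 1)) (Var 0)))
           (Lam (arrow (decision u (Var 1)) (Empty u))
             (InR (App (TrIn (arrow (Var 2) (Empty u))) (Lam (Var 2) (App (Var 1) (InL (Var 0))))))))
           (App (App (Var 2) (Plus (decision u (Var 1)) (Unit u)))
             (App (TrIn (Plus (decision u (Var 1)) (Unit u))) (InR (Star u))))))))"

lemma injective_imp_em_ty [ty]:
  "ctx \<Gamma> \<Longrightarrow> T = arrow (all_inhabited_injective u) (excluded_middle u) \<Longrightarrow>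
   \<Gamma> \<turnstile> injective_imp_em u \<Colon> T"
  apply hypsubst
  apply (simp add: injective_imp_em_def all_inhabited_injective_def excluded_middle_def
    injective_def eval_nat_numeral)
  \<comment> \<open>The type of \<open>injective_retract\<close> mentions \<open>injective\<close>
    folded; substitution computes only after unfolding it.\<close>
  apply (assumption | rule ty | simp (no_asm) add: injective_def eval_nat_numeral)+
  done

section \<open>From excluded middle to injectivity\<close>

definition at_fiber :: "tm \<Rightarrow> tm \<Rightarrow> tm \<Rightarrow> tm" where [simp]:
  "at_fiber D f w = SigE (wk D) (App (wk (wk f)) (Var 1)) w"

definition choice :: "tm \<Rightarrow> tm \<Rightarrow> tm \<Rightarrow> tm \<Rightarrow> tm" where [simp]:
  "choice D f d s = PlusE (wk D) (at_fiber (wk D) (wk f) (Var 0)) (wk d) s"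

definition own_fiber :: "tm \<Rightarrow> tm \<Rightarrow> tm" where [simp]:
  "own_fiber k x = Pr x (Refl (App k x))"

text \<open>
  An open term: the variables 0 to 9 are an element of the fiber over \<open>k x\<close>, the decision of this
  fiber, the proof that it is a proposition, \<open>x\<close>, \<open>d\<close>, \<open>f\<close>, \<open>k\<close>, \<open>D\<close>, \<open>Y\<close> and
  \<open>X\<close>.
\<close>

definition at_fiber_path :: "tm" where [simp]:
  "at_fiber_path =
    IdE (Idn (Var 10) (at_fiber (Var 10) (Var 8) (Var 2)) (at_fiber (Var 10) (Var 8) (Var 1)))
      (Refl (at_fiber (Var 8) (Var 6) (Var 0))) (Var 0) (own_fiber (Var 6) (Var 3))
      (App (App (Var 2) (Var 0)) (own_fiber (Var 6) (Var 3)))"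

text \<open>The fiber over \<open>k x\<close> is a proposition, so its given element equals
  \<open>own_fiber k x\<close>, and \<open>at_fiber\<close> carries this path to \<open>D\<close>.
  The ends agree with the stated ones by computation.\<close>

lemma at_fiber_path_ty:
  fixes u \<Gamma>
  defines "\<Delta> \<equiv> fiber (Var 8) (Var 7) (Var 5) (App (Var 5) (Var 2)) #
    Plus (fiber (Var 7) (Var 6) (Var 4) (App (Var 4) (Var 1)))
      (arrow (fiber (Var 7) (Var 6) (Var 4) (App (Var 4) (Var 1))) (Empty u)) #
    is_prop (fiber (Var 6) (Var 5) (Var 3) (App (Var 3) (Var 0))) #
    Var 5 # Var 2 # arrow (Var 3) (Var 1) # arrow (Var 2) (Var 1) # Univ u # Univ u # Univ u # \<Gamma>"
  assumes "ctx \<Delta>"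
  shows "\<Delta> \<turnstile> at_fiber_path
    \<Colon> Idn (Var 7) (choice (Var 7) (Var 5) (Var 4) (InL (Var 0))) (App (Var 5) (Var 3))"
  using assms(2) unfolding \<Delta>_def
  apply (simp add: eval_nat_numeral)
  apply (rule Idn_conv)
  apply (assumption | rule ty | simp (no_asm))+
  apply (rule eq_sym)
  \<comment> \<open>\<open>InL\<close> does not determine the right summand; it is the negation of
    the fiber.\<close>
  apply (rule PlusE_InL_eq[where B = "arrow (fiber (Var 9) (Var 8) (Var 6) (App (Var 6) (Var 3))) (Empty u)",
     unfolded eval_nat_numeral BitM.simps, simplified])
  apply (assumption | rule ty | simp (no_asm))+
  \<comment> \<open>At \<open>own_fiber\<close> the map \<open>at_fiber\<close> computes to
    \<open>f x\<close>; the type of the pair has to be supplied.\<close>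
  apply (rule SigE_Pr_eq[where A = "Var 9" and B = "Idn (Var 9) (App (Var 7) (Var 0)) (App (Var 7) (Var 4))",
     unfolded eval_nat_numeral BitM.simps, simplified])
  apply (assumption | rule ty | simp (no_asm))+
  done

text \<open>The decision is an arbitrary variable, so that it can be split into cases. A negative
  decision is refuted by \<open>own_fiber\<close>.\<close>

definition choice_eq :: "nat \<Rightarrow> tm" where
  "choice_eq u = Lam (Univ u) (Lam (Univ u) (Lam (Univ u) (Lam (arrow (Var 2) (Var 1))
     (Lam (arrow (Var 3) (Var 1)) (Lam (Var 2) (Lam (Var 5)
       (Lam (is_prop (fiber (Var 6) (Var 5) (Var 3) (App (Var 3) (Var 0))))
         (Lam (Plus (fiber (Var 7) (Var 6) (Var 4) (App (Var 4) (Var 1)))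
             (arrow (fiber (Var 7) (Var 6) (Var 4) (App (Var 4) (Var 1))) (Empty u)))
           (PlusE (Idn (Var 7) (choice (Var 7) (Var 5) (Var 4) (Var 0)) (App (Var 5) (Var 3)))
             at_fiber_path
             (EmptyE (Idn (Var 8) (choice (Var 8) (Var 6) (Var 5) (InR (Var 1))) (App (Var 6) (Var 4)))
               (App (Var 0) (own_fiber (Var 6) (Var 3))))
             (Var 0))))))))))"

lemma choice_eq_ty [ty]:
  "ctx \<Gamma> \<Longrightarrow>
   T = Pi (Univ u) (Pi (Univ u) (Pi (Univ u) (Pi (arrow (Var 2) (Var 1))
     (Pi (arrow (Var 3) (Var 1)) (Pi (Var 2) (Pi (Var 5)
       (Pi (is_prop (fiber (Var 6) (Var 5) (Var 3) (App (Var 3) (Var 0))))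
         (Pi (Plus (fiber (Var 7) (Var 6) (Var 4) (App (Var 4) (Var 1)))
             (arrow (fiber (Var 7) (Var 6) (Var 4) (App (Var 4) (Var 1))) (Empty u)))
           (Idn (Var 6) (choice (Var 6) (Var 4) (Var 3) (Var 0)) (App (Var 4) (Var 2)))))))))))
   \<Longrightarrow> \<Gamma> \<turnstile> choice_eq u \<Colon> T"
  apply hypsubst
  apply (simp add: choice_eq_def eval_nat_numeral)
  apply (assumption |
    rule at_fiber_path_ty[simplified, unfolded eval_nat_numeral BitM.simps, simplified]
    InR_ty[where b = "Var 1" and A = "fiber (Var 10) (Var 9) (Var 7) (App (Var 7) (Var 4))",
      unfolded eval_nat_numeral BitM.simps, simplified] ty | simp (no_asm))+
  done

lemma choice_eq_closed [simp]:
  "ren \<xi> (choice_eq u) = choice_eq u" "sub \<sigma> (choice_eq u) = choice_eq u"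
  by (simp_all add: choice_eq_def eval_nat_numeral)

section \<open>The extension obtained from excluded middle\<close>

definition decide_fiber :: "tm \<Rightarrow> tm \<Rightarrow> tm \<Rightarrow> tm \<Rightarrow> tm \<Rightarrow> tm \<Rightarrow> tm" where [simp]:
  "decide_fiber em X Y k e y = App (App em (fiber X Y k y)) (App e y)"

text \<open>The embedding appears as an explicit pair, the form it takes after elimination by
  \<open>SigE\<close>.\<close>

definition extensions :: "tm \<Rightarrow> tm \<Rightarrow> tm \<Rightarrow> tm \<Rightarrow> tm \<Rightarrow> tm \<Rightarrow> tm" where [simp]:
  "extensions X Y D k e f = Sig (arrow Y D)
     (homotopy (wk X) (wk D) (comp (wk X) (Var 0) (pr1 (arrow (wk X) (wk Y)) (Pr (wk k) (wk e)))) (wk f))"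

text \<open>
  Open terms: the variables of \<open>extension_map\<close> are \<open>d\<close>, \<open>f\<close>, \<open>e\<close>, \<open>k\<close>,
  \<open>D\<close>, \<open>Y\<close>, \<open>X\<close> and a proof of excluded middle; those of \<open>extension_eq\<close> are
  preceded by \<open>x\<close>.
\<close>

definition extension_map :: tm where [simp]:
  "extension_map = Lam (Var 5) (choice (Var 5) (Var 2) (Var 1)
     (decide_fiber (Var 8) (Var 7) (Var 6) (Var 4) (Var 3) (Var 0)))"

definition extension_eq :: "nat \<Rightarrow> tm" where [simp]:
  "extension_eq u = App (App (App (App (App (App (App (App (App (choice_eq u)
     (Var 7)) (Var 6)) (Var 5)) (Var 4)) (Var 2)) (Var 1)) (Var 0)) (App (Var 3) (App (Var 4) (Var 0))))
     (decide_fiber (Var 8) (Var 7) (Var 6) (Var 4) (Var 3) (App (Var 4) (Var 0)))"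

text \<open>This is \<open>choice_eq\<close> for the decision of the fiber over \<open>k x\<close>;
  its left end is what the composite at \<open>x\<close> computes to.\<close>

lemma extension_eq_ty:
  fixes u \<Gamma>
  defines "\<Delta> \<equiv> Var 6 # Var 3 # arrow (Var 4) (Var 2) # is_embedding (Var 3) (Var 2) (Var 0) #
    arrow (Var 2) (Var 1) # Univ u # Univ u # Univ u # excluded_middle u # \<Gamma>"
  assumes "ctx \<Delta>"
  shows "\<Delta> \<turnstile> extension_eq u \<Colon> Idn (Var 5)
    (App (comp (Var 7) (wk extension_map) (pr1 (arrow (Var 7) (Var 6)) (Pr (Var 4) (Var 3)))) (Var 0))
    (App (Var 2) (Var 0))"
  using assms(2) unfolding \<Delta>_def
  apply (simp add: excluded_middle_def eval_nat_numeral)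
  apply (rule Idn_conv)
  apply (assumption | rule ty | simp (no_asm))+
  apply (rule eq_sym)
  apply (rule eq_trans)
  apply (rule App_Lam_eq)
  apply (assumption | rule pr1_embedding_ty ty | simp (no_asm))+
  apply (rule eq_trans)
  apply (rule cong_App_eq)
  apply (rule eq_refl)
  apply (assumption | rule pr1_embedding_ty ty | simp (no_asm))+
  \<comment> \<open>The argument of the extension: the first projection of the embedding computes to
    \<open>k\<close>.\<close>
  apply (rule cong_App_eq)
  apply (rule pr1_embedding_eq)
  apply (assumption | rule pr1_embedding_ty ty | simp (no_asm))+
  apply (rule eq_refl)
  apply (assumption | rule pr1_embedding_ty ty | simp (no_asm))+
  apply (rule App_Lam_eq)
  apply (assumption | rule pr1_embedding_ty ty | simp (no_asm))+
  apply (rule eq_refl)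
  apply (assumption | rule pr1_embedding_ty ty | simp (no_asm))+
  done

definition extension :: "nat \<Rightarrow> tm" where
  "extension u = Lam (excluded_middle u) (Lam (Univ u) (Lam (Univ u) (Lam (Univ u)
     (Lam (arrow (Var 2) (Var 1)) (Lam (is_embedding (Var 3) (Var 2) (Var 0))
       (Lam (arrow (Var 4) (Var 2)) (Lam (Var 3)
         (Pr extension_map (Lam (Var 6) (extension_eq u))))))))))"

lemma extension_ty [ty]:
  "ctx \<Gamma> \<Longrightarrow>
   T = Pi (excluded_middle u) (Pi (Univ u) (Pi (Univ u) (Pi (Univ u)
     (Pi (arrow (Var 2) (Var 1)) (Pi (is_embedding (Var 3) (Var 2) (Var 0))
       (Pi (arrow (Var 4) (Var 2)) (Pi (Var 3)
         (extensions (Var 6) (Var 5) (Var 4) (Var 3) (Var 2) (Var 1))))))))) \<Longrightarrow>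
   \<Gamma> \<turnstile> extension u \<Colon> T"
  apply hypsubst
  apply (simp add: extension_def excluded_middle_def eval_nat_numeral)
  apply (assumption | rule extension_eq_ty[simplified, unfolded eval_nat_numeral BitM.simps
      excluded_middle_def, simplified]
    pr1_embedding_ty ty | simp (no_asm))+
  done

lemma extension_closed [simp]:
  "ren \<xi> (extension u) = extension u" "sub \<sigma> (extension u) = extension u"
  by (simp_all add: extension_def excluded_middle_def eval_nat_numeral)

text \<open>Only the truncation of the codomain is given, but the goal is itself a truncation, hence
  a proposition by \<open>TrProp\<close>, so a point may be assumed.\<close>

definition em_imp_injective :: "nat \<Rightarrow> tm" where
  "em_imp_injective u = Lam (excluded_middle u) (Lam (Univ u) (Lam (Trunc (Var 0))
     (Lam (Univ u) (Lam (Univ u) (Lam (embedding (Var 1) (Var 0)) (Lam (arrow (Var 2) (Var 4))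
       (SigE
         (ex (arrow (Var 3) (Var 6))
            (homotopy (Var 5) (Var 7) (comp (Var 5) (Var 0) (pr1 (arrow (Var 5) (Var 4)) (Var 1))) (Var 2)))
         (App (App (App
           (TrRec (Var 7) (Trunc (extensions (Var 5) (Var 4) (Var 7) (Var 1) (Var 0) (Var 2))))
           (TrProp (extensions (Var 5) (Var 4) (Var 7) (Var 1) (Var 0) (Var 2))))
           (Lam (Var 7) (App (TrIn (extensions (Var 6) (Var 5) (Var 8) (Var 2) (Var 1) (Var 3)))
             (App (App (App (App (App (App (App (App (extension u) (Var 9)) (Var 6)) (Var 5)) (Var 8))
               (Var 2)) (Var 1)) (Var 3)) (Var 0)))))
           (Var 6))
         (Var 1))))))))"

lemma em_imp_injective_ty [ty]:
  "ctx \<Gamma> \<Longrightarrow> T = arrow (excluded_middle u) (all_inhabited_injective u) \<Longrightarrow>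
   \<Gamma> \<turnstile> em_imp_injective u \<Colon> T"
  apply hypsubst
  apply (simp add: em_imp_injective_def all_inhabited_injective_def excluded_middle_def
    injective_def eval_nat_numeral)
  apply (assumption | rule pr1_embedding_ty ty | simp (no_asm) add: excluded_middle_def eval_nat_numeral)+
  done

theorem theorem64:
  fixes u :: nat
  shows "\<exists>t. [] \<turnstile> t \<Colon>
           arrow (Omega_resizing u) (logical_equiv (all_inhabited_injective u) (excluded_middle u))"
proof
  show "[] \<turnstile> Lam (Omega_resizing u) (Pr (injective_imp_em u) (em_imp_injective u)) \<Colon>
           arrow (Omega_resizing u) (logical_equiv (all_inhabited_injective u) (excluded_middle u))"
    using ctx_Nil apply simp
    by (assumption | rule ty | simp (no_asm))+
qed

end
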